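(* For any positive integers $K$ and $t$ with $(t+1)\nmid K$ and $\lfloor K/2\rfloor>t+1$, let $K'$ be the minimum integer satisfying $K'>K$ and $(t+1)\mid K'$. There always exists a $\left(K,\ \binom{K}{t}+\binom{K'-1}{t},\ \binom{K-1}{t-1}+\binom{K'-1}{t}-\binom{K-1}{t},\ \binom{K}{t+1}\right)$ SPDA, which gives a $(K,M,N)$ secure coded caching scheme with $$\frac{M}{N}=\frac{\binom{K-1}{t-1}+\binom{K'-1}{t}}{\binom{K}{t}+\binom{K'-1}{t}},$$ transmission rate $$R=\frac{\binom{K}{t+1}}{\binom{K}{t}+\binom{K'-1}{t}}$$ and subpacketization $\binom{K}{t}+\binom{K'-1}{t}$.
   Context: For a positive integer $n$, $[0,n)=\{0,1,\dots,n-1\}$. SPDA. For positive integers $K,F$, an $F\times K$ array $\mathbf{P}=(p_{j,k})_{j\in[0,F),k\in[0,K)}$ with entries in $\{*\}\cup[0,S)$ is a $(K,F,Z,S)$ secure placement delivery array (SPDA) if: (C1) the symbol $*$ appears exactly $Z$ times in each column; (C2) each $s\in[0,S)$ appears at least four times; (C3) for each $s\in[0,S)$, the subarray $\mathbf{P}^{(s)}$ formed by all rows and columns containing $s$ is, up to row and column permutations, a $(g+1)\times g$ array (for some $g$ depending on $s$) whose first row has all entries equal to $s$ and whose remaining $g$ rows form the $g\times g$ array with $s$ on the diagonal and $*$ off the diagonal. For each $s$, let $\mathcal{U}_s$ be the set of columns containing $s$ and let $j^{(s)}$ be the unique row containing $s$ at least twice. Caching system. A server holds $N$ files $W_0,\dots,W_{N-1}$,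 independent and uniform on $\{0,1\}^B$ (with $F\mid B$), and serves $K$ users $[0,K)$ over a shared link; each user has a cache for file content of $MB$ bits (the cache space used by keys is not counted). User $k$ requests $W_{d_k}$; $\mathbf{d}=(d_0,\dots,d_{K-1})$ is random, independent of everything else, and $\mathbf{d}_{-k}$ is $\mathbf{d}$ with $d_k$ removed. The requested files are assumed to be pairwise different (so $N\ge K$), $\mathbf{d}$ being uniform on such vectors. The scheme given by an SPDA $\mathbf{P}$. The server draws independent uniformly random permutations $\phi_0,\dots,\phi_{N-1}$ of $[0,F)$, known only to itself. Each $W_n$ is split into $F$ packets of $B/F$ bits, the packet in position $j$ carrying the public label $\phi_n(j)$; the labelled packet is written $W_{n,\phi_n(j)}$. User $k$ caches the labelled packets $\mathcal{Z}_k=\{W_{n,\phi_n(j)}: p_{j,k}=*,\ n\in[0,N)\}\cup\{W_{n,\phi_n(j^{(s)})}: p_{j^{(s)},k}=s,\ s\in[0,S),\ n\in[0,N)\}$ and the keys $\mathcal{T}_k=\{T_{\mathcal{U}_s}:k\in\mathcal{U}_s\}$, the keys (one per $s$) being independent and uniform on $\{0,1\}^{B/F}$. Let $\mathfrak{U}_k=\{\mathcal{U}_s:k\in\mathcal{U}_s\}$. For each $s\in[0,S)$ the server broadcasts $T_{\mathcal{U}_s}\oplus X_{\mathcal{U}_s}$, where $$X_{\mathcal{U}_s}=\Big(\bigoplus_{\substack{k\in\mathcal{U}_s,\ j\ne j^{(s)}\\ p_{j,k}=s}}W_{d_k,\phi_{d_k}(j)}\Big)\oplus\Big(\bigoplus_{n\in[0,N)\setminus\{d_k:\,k\in\mathcal{U}_s\}}W_{n,\phi_n(j^{(s)})}\Big),$$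 with a header of negligible length giving $\mathcal{U}_s$ and the file indices and labels of the packets in $X_{\mathcal{U}_s}$ (in information quantities $X_{\mathcal{U}_s}$ is understood together with this header), and sends $\phi_{d_k}$ privately to user $k$. Such a scheme is a secure coded caching scheme if, for every $k$, $H(W_{d_k}\mid \mathcal{Z}_k,\mathcal{T}_k,\{T_{\mathcal{U}_s}\oplus X_{\mathcal{U}_s}:k\in\mathcal{U}_s\},\phi_{d_k})=0$ (headers included) and $I(\mathbf{d}_{-k};\{X_{\mathcal{U}_s}:k\in\mathcal{U}_s\}\mid\phi_{d_k},\mathcal{Z}_k,d_k,\mathfrak{U}_k)=0$. The rate $R$ is the total number of broadcast bits (excluding headers) divided by $B$; the subpacketization is the number $F$ of packets per file. *)

theory Defs
  imports
    "HOL-Probability.Probability"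
    "HOL-Combinatorics.Permutations"
    "HOL-Library.Z2"
begin

section \<open>Secure placement delivery arrays\<close>

datatype spda_entry = Star | Sym nat

type_synonym spda_array = "nat \<Rightarrow> nat \<Rightarrow> spda_entry"

text \<open>An array is applied to a row \<open>j < F\<close> and then a column \<open>k < K\<close>; values outside
  this range are irrelevant.\<close>

definition rows_with :: "nat \<Rightarrow> nat \<Rightarrow> spda_array \<Rightarrow> nat \<Rightarrow> nat set" where
  "rows_with K F P s = {j. j < F \<and> (\<exists>k<K. P j k = Sym s)}"

definition cols_with :: "nat \<Rightarrow> nat \<Rightarrow> spda_array \<Rightarrow> nat \<Rightarrow> nat set" where
  "cols_with K F P s = {k. k < K \<and> (\<exists>j<F. P j k = Sym s)}"

text \<open>In the last conjunct \<open>r\<close> and \<open>c\<close> enumerate the rows and columns containing \<open>s\<close>,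
  that is, they are the row and column permutations; row \<open>0\<close> of the permuted subarray is the
  constant one.\<close>

definition spda :: "nat \<Rightarrow> nat \<Rightarrow> nat \<Rightarrow> nat \<Rightarrow> spda_array \<Rightarrow> bool" where
  "spda K F Z S P \<longleftrightarrow>
     0 < K \<and> 0 < F \<and>
     (\<forall>j<F. \<forall>k<K. P j k = Star \<or> (\<exists>s<S. P j k = Sym s)) \<and>
     (\<forall>k<K. card {j. j < F \<and> P j k = Star} = Z) \<and>
     (\<forall>s<S. 4 \<le> card {(j, k). j < F \<and> k < K \<and> P j k = Sym s}) \<and>
     (\<forall>s<S. \<exists>(g::nat) r c.
        bij_betw r {..<g + 1} (rows_with K F P s) \<and>
        bij_betw c {..<g} (cols_with K F P s) \<and>
        (\<forall>l<g. P (r 0) (c l) = Sym s) \<and>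
        (\<forall>i<g. \<forall>l<g. P (r (i + 1)) (c l) = (if i = l then Sym s else Star)))"

text \<open>The unique row containing \<open>s\<close> at least twice.\<close>

definition lead_row :: "nat \<Rightarrow> nat \<Rightarrow> spda_array \<Rightarrow> nat \<Rightarrow> nat" where
  "lead_row K F P s = (THE j. j < F \<and> 2 \<le> card {k. k < K \<and> P j k = Sym s})"

definition syms_of :: "nat \<Rightarrow> nat \<Rightarrow> nat \<Rightarrow> spda_array \<Rightarrow> nat \<Rightarrow> nat set" where
  "syms_of K F S P k = {s. s < S \<and> k \<in> cols_with K F P s}"


section \<open>Bit strings and packets\<close>

text \<open>Bits are elements of the field with two elements, so exclusive or is addition.\<close>

definition bitstrings :: "nat \<Rightarrow> bit list set" where
  "bitstrings L = {w. length w = L}"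

definition xor :: "bit list \<Rightarrow> bit list \<Rightarrow> bit list" where
  "xor v w = map2 (+) v w"

definition xor_sum :: "nat \<Rightarrow> 'i set \<Rightarrow> ('i \<Rightarrow> bit list) \<Rightarrow> bit list" where
  "xor_sum L A f = map (\<lambda>i. \<Sum>x\<in>A. f x ! i) [0..<L]"

definition split_file :: "nat \<Rightarrow> nat \<Rightarrow> bit list \<Rightarrow> bit list list" where
  "split_file B F w = map (\<lambda>j. take (B div F) (drop (j * (B div F)) w)) [0..<F]"

definition packet :: "nat \<Rightarrow> nat \<Rightarrow> bit list \<Rightarrow> nat \<Rightarrow> bit list" where
  "packet B F w j = split_file B F w ! j"


section \<open>The random experiment\<close>

text \<open>An outcome consists of the files \<open>W\<close>, the demand vector \<open>d\<close>, the label permutations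
  \<open>\<phi>\<close> and the keys \<open>T\<close> (the key of \<open>\<U>\<^sub>s\<close> is indexed by \<open>s\<close>). The uniform distribution on
  the product set makes all components independent, with each file, permutation and key uniform
  and the demand vector uniform on vectors with pairwise different entries.\<close>

type_synonym outcome =
  "(nat \<Rightarrow> bit list) \<times> (nat \<Rightarrow> nat) \<times> (nat \<Rightarrow> nat \<Rightarrow> nat) \<times> (nat \<Rightarrow> bit list)"

definition outcomes :: "nat \<Rightarrow> nat \<Rightarrow> nat \<Rightarrow> nat \<Rightarrow> nat \<Rightarrow> outcome set" where
  "outcomes K F S N B =
     ({..<N} \<rightarrow>\<^sub>E bitstrings B)
     \<times> {d \<in> {..<K} \<rightarrow>\<^sub>E {..<N}. inj_on d {..<K}}
     \<times> ({..<N} \<rightarrow>\<^sub>E {\<pi>. \<pi> permutes {..<F}})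
     \<times> ({..<S} \<rightarrow>\<^sub>E bitstrings (B div F))"

definition outcome_measure :: "nat \<Rightarrow> nat \<Rightarrow> nat \<Rightarrow> nat \<Rightarrow> nat \<Rightarrow> outcome measure" where
  "outcome_measure K F S N B = uniform_count_measure (outcomes K F S N B)"

text \<open>Information quantities of random variables of finite range, in bits.\<close>

definition cond_entropy :: "'o measure \<Rightarrow> ('o \<Rightarrow> 'x) \<Rightarrow> ('o \<Rightarrow> 'y) \<Rightarrow> real" where
  "cond_entropy Q X Y = prob_space.conditional_entropy Q 2
     (count_space (X ` space Q)) (count_space (Y ` space Q)) X Y"

definition cond_mutual_info ::
    "'o measure \<Rightarrow> ('o \<Rightarrow> 'x) \<Rightarrow> ('o \<Rightarrow> 'y) \<Rightarrow> ('o \<Rightarrow> 'z) \<Rightarrow> real" where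
  "cond_mutual_info Q X Y Z = prob_space.conditional_mutual_information Q 2
     (count_space (X ` space Q)) (count_space (Y ` space Q)) (count_space (Z ` space Q)) X Y Z"


section \<open>The coded caching scheme of an array\<close>

text \<open>A labelled packet is a triple of file index, public label and content. The cache is an
  unordered set of such triples: it does not reveal the positions of the packets.\<close>

definition cached_packets ::
    "nat \<Rightarrow> nat \<Rightarrow> nat \<Rightarrow> nat \<Rightarrow> nat \<Rightarrow> spda_array \<Rightarrow> nat \<Rightarrow> outcome \<Rightarrow> (nat \<times> nat \<times> bit list) set" where
  "cached_packets K F S N B P k = (\<lambda>(W, d, \<phi>, T).
     {(n, \<phi> n j, packet B F (W n) j) | n j. n < N \<and> j < F \<and> P j k = Star} \<union>
     {(n, \<phi> n (lead_row K F P s), packet B F (W n) (lead_row K F P s)) | n s.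
        n < N \<and> s < S \<and> P (lead_row K F P s) k = Sym s})"

definition cached_keys ::
    "nat \<Rightarrow> nat \<Rightarrow> nat \<Rightarrow> spda_array \<Rightarrow> nat \<Rightarrow> outcome \<Rightarrow> nat \<Rightarrow> bit list" where
  "cached_keys K F S P k = (\<lambda>(W, d, \<phi>, T). restrict T (syms_of K F S P k))"

definition demanded_cells :: "nat \<Rightarrow> nat \<Rightarrow> spda_array \<Rightarrow> nat \<Rightarrow> (nat \<times> nat) set" where
  "demanded_cells K F P s =
     {(k, j). k \<in> cols_with K F P s \<and> j < F \<and> j \<noteq> lead_row K F P s \<and> P j k = Sym s}"

definition undemanded_files :: "nat \<Rightarrow> nat \<Rightarrow> nat \<Rightarrow> spda_array \<Rightarrow> nat \<Rightarrow> (nat \<Rightarrow> nat) \<Rightarrow> nat set" where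
  "undemanded_files K F N P s d = {..<N} - d ` cols_with K F P s"

definition payload ::
    "nat \<Rightarrow> nat \<Rightarrow> nat \<Rightarrow> nat \<Rightarrow> spda_array \<Rightarrow> nat \<Rightarrow> outcome \<Rightarrow> bit list" where
  "payload K F N B P s = (\<lambda>(W, d, \<phi>, T).
     xor (xor_sum (B div F) (demanded_cells K F P s) (\<lambda>(k, j). packet B F (W (d k)) j))
         (xor_sum (B div F) (undemanded_files K F N P s d)
            (\<lambda>n. packet B F (W n) (lead_row K F P s))))"

text \<open>The pairs of file index and label form an unordered set, so a header does not show which
  packets come from the first sum.\<close>

definition header ::
    "nat \<Rightarrow> nat \<Rightarrow> nat \<Rightarrow> spda_array \<Rightarrow> nat \<Rightarrow> outcome \<Rightarrow> nat set \<times> (nat \<times> nat) set" where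
  "header K F N P s = (\<lambda>(W, d, \<phi>, T).
     (cols_with K F P s,
      (\<lambda>(k, j). (d k, \<phi> (d k) j)) ` demanded_cells K F P s \<union>
      (\<lambda>n. (n, \<phi> n (lead_row K F P s))) ` undemanded_files K F N P s d))"

definition broadcast ::
    "nat \<Rightarrow> nat \<Rightarrow> nat \<Rightarrow> nat \<Rightarrow> spda_array \<Rightarrow> nat \<Rightarrow> outcome \<Rightarrow> bit list" where
  "broadcast K F N B P s = (\<lambda>(W, d, \<phi>, T). xor (T s) (payload K F N B P s (W, d, \<phi>, T)))"

definition broadcasts_for ::
    "nat \<Rightarrow> nat \<Rightarrow> nat \<Rightarrow> nat \<Rightarrow> nat \<Rightarrow> spda_array \<Rightarrow> nat \<Rightarrow> outcome
     \<Rightarrow> nat \<Rightarrow> (nat set \<times> (nat \<times> nat) set) \<times> bit list" where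
  "broadcasts_for K F S N B P k = (\<lambda>\<omega>.
     \<lambda>s\<in>syms_of K F S P k. (header K F N P s \<omega>, broadcast K F N B P s \<omega>))"

definition messages_for ::
    "nat \<Rightarrow> nat \<Rightarrow> nat \<Rightarrow> nat \<Rightarrow> nat \<Rightarrow> spda_array \<Rightarrow> nat \<Rightarrow> outcome
     \<Rightarrow> nat \<Rightarrow> (nat set \<times> (nat \<times> nat) set) \<times> bit list" where
  "messages_for K F S N B P k = (\<lambda>\<omega>.
     \<lambda>s\<in>syms_of K F S P k. (header K F N P s \<omega>, payload K F N B P s \<omega>))"

definition requested_file :: "nat \<Rightarrow> outcome \<Rightarrow> bit list" where
  "requested_file k = (\<lambda>(W, d, \<phi>, T). W (d k))"

definition private_permutation :: "nat \<Rightarrow> outcome \<Rightarrow> nat \<Rightarrow> nat" where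
  "private_permutation k = (\<lambda>(W, d, \<phi>, T). \<phi> (d k))"

definition own_demand :: "nat \<Rightarrow> outcome \<Rightarrow> nat" where
  "own_demand k = (\<lambda>(W, d, \<phi>, T). d k)"

definition other_demands :: "nat \<Rightarrow> nat \<Rightarrow> outcome \<Rightarrow> nat \<Rightarrow> nat" where
  "other_demands K k = (\<lambda>(W, d, \<phi>, T). restrict d ({..<K} - {k}))"

text \<open>\<open>\<UU>\<^sub>k\<close> is deterministic, hence a constant random variable.\<close>

definition user_groups :: "nat \<Rightarrow> nat \<Rightarrow> nat \<Rightarrow> spda_array \<Rightarrow> nat \<Rightarrow> outcome \<Rightarrow> nat set set" where
  "user_groups K F S P k = (\<lambda>_. cols_with K F P ` syms_of K F S P k)"

definition decodable ::
    "nat \<Rightarrow> nat \<Rightarrow> nat \<Rightarrow> nat \<Rightarrow> nat \<Rightarrow> spda_array \<Rightarrow> bool" where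
  "decodable K F S N B P \<longleftrightarrow>
     (\<forall>k<K. cond_entropy (outcome_measure K F S N B)
        (requested_file k)
        (\<lambda>\<omega>. (cached_packets K F S N B P k \<omega>, cached_keys K F S P k \<omega>,
               broadcasts_for K F S N B P k \<omega>, private_permutation k \<omega>)) = 0)"

definition demand_private ::
    "nat \<Rightarrow> nat \<Rightarrow> nat \<Rightarrow> nat \<Rightarrow> nat \<Rightarrow> spda_array \<Rightarrow> bool" where
  "demand_private K F S N B P \<longleftrightarrow>
     (\<forall>k<K. cond_mutual_info (outcome_measure K F S N B)
        (other_demands K k)
        (messages_for K F S N B P k)
        (\<lambda>\<omega>. (private_permutation k \<omega>, cached_packets K F S N B P k \<omega>,
               own_demand k \<omega>, user_groups K F S P k \<omega>)) = 0)"

text \<open>Every user's file cache holds exactly \<open>M * B\<close> bits.\<close>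

definition has_memory ::
    "nat \<Rightarrow> nat \<Rightarrow> nat \<Rightarrow> nat \<Rightarrow> nat \<Rightarrow> spda_array \<Rightarrow> real \<Rightarrow> bool" where
  "has_memory K F S N B P M \<longleftrightarrow>
     (\<forall>\<omega>\<in>outcomes K F S N B. \<forall>k<K.
        real (\<Sum>(n, l, w)\<in>cached_packets K F S N B P k \<omega>. length w) = M * real B)"

definition has_rate ::
    "nat \<Rightarrow> nat \<Rightarrow> nat \<Rightarrow> nat \<Rightarrow> nat \<Rightarrow> spda_array \<Rightarrow> real \<Rightarrow> bool" where
  "has_rate K F S N B P R \<longleftrightarrow>
     (\<forall>\<omega>\<in>outcomes K F S N B.
        real (\<Sum>s<S. length (broadcast K F N B P s \<omega>)) / real B = R)"

definition has_subpacketization ::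
    "nat \<Rightarrow> nat \<Rightarrow> nat \<Rightarrow> nat \<Rightarrow> nat \<Rightarrow> nat \<Rightarrow> bool" where
  "has_subpacketization K F S N B q \<longleftrightarrow>
     (\<forall>(W, d, \<phi>, T)\<in>outcomes K F S N B. \<forall>n<N. length (split_file B F (W n)) = q)"

definition secure_coded_caching_scheme ::
    "nat \<Rightarrow> real \<Rightarrow> nat \<Rightarrow> nat \<Rightarrow> nat \<Rightarrow> nat \<Rightarrow> spda_array \<Rightarrow> bool" where
  "secure_coded_caching_scheme K M N B F S P \<longleftrightarrow>
     has_memory K F S N B P M \<and> decodable K F S N B P \<and> demand_private K F S N B P"

end

theory Submission
  imports Defs
begin

text \<open>The array stacks the Maddah-Ali--Niesen array, whose rows are the \<open>t\<close>-subsets and whose symbols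
  are the \<open>(t + 1)\<close>-subsets of the users, on top of rows that hold pairwise disjoint \<open>(t + 1)\<close>-subsets.
  Baranyai's theorem on \<open>K'\<close> points, restricted to the first \<open>K\<close>, shows that \<open>(K' - 1) choose t\<close> such
  rows suffice.

  Every \<open>X\<^bsub>\<U>\<^sub>s\<^esub>\<close> contains exactly one packet of each file, and for a user in \<open>\<U>\<^sub>s\<close> all but the packet
  of the own requested file are cached. The user recognises the missing packet by its label, learns
  from it which file was requested, and decodes. For privacy, two demand vectors \<open>d\<close>, \<open>d'\<close> with
  \<open>d k = d' k\<close> are compared: rearranging the positions of each file \<open>n \<noteq> d k\<close> by a permutation of the
  rows cached by user \<open>k\<close> maps the outcomes with demand \<open>d\<close> injectively to outcomes with demand \<open>d'\<close>
  and changes nothing that the user sees. Hence the conditional counts do not depend on the other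
  demands.\<close>

section \<open>Information quantities on finite uniform spaces\<close>

text \<open>The parameters come from two counts. In Baranyai's theorem on \<open>K'\<close> points,
  every point lies in \<open>(K' - 1) choose t\<close> subsets of size \<open>t + 1\<close>, one in
  each partition; this is the number of partitions, hence of rows added to the Maddah-Ali--Niesen
  array. A user belongs to \<open>u = (K - 1) choose t\<close> of the \<open>(t + 1)\<close>-subsets
  of users, all of different colours, so exactly \<open>u\<close> of the added rows hold a symbol in
  that user's column. Every symbol of a column occurs there once in its constant row and once on its
  diagonal, so \<open>F = Z + 2 * u\<close>. Of these, the \<open>Z\<close> stars and the
  \<open>u\<close> constant-row entries are cached, which gives the numerator of
  \<open>M / N\<close>.

  The obstacle to privacy is that a single rearrangement of each file has to serve all messages to a
  user at once. It exists because, for a file other than the requested one, different symbols of the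
  user take their packet from different rows, all of them cached. For the requested file, whose
  permutation the user knows, the row does not depend on the other demands, so nothing is
  moved.\<close>

lemma information_space_uniform_count:
  assumes "finite \<Omega>" "\<Omega> \<noteq> {}"
  shows "information_space (uniform_count_measure \<Omega>) 2"
proof -
  interpret prob_space "uniform_count_measure \<Omega>"
    using assms by (rule prob_space_uniform_count_measure)
  show ?thesis by unfold_locales simp
qed

lemma simple_distributed_uniform_count:
  assumes "finite \<Omega>" "\<Omega> \<noteq> {}"
  shows "simple_distributed (uniform_count_measure \<Omega>) X
           (\<lambda>x. real (card {\<omega>\<in>\<Omega>. X \<omega> = x}) / real (card \<Omega>))"
proof -
  interpret prob_space "uniform_count_measure \<Omega>"
    using assms by (rule prob_space_uniform_count_measure)
  show ?thesis
  proof (rule simple_distributedI)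
    show "simple_function (uniform_count_measure \<Omega>) X"
      using assms by (auto simp: simple_function_def space_uniform_count_measure sets_uniform_count_measure)
    fix x
    have "X -` {x} \<inter> \<Omega> = {\<omega>\<in>\<Omega>. X \<omega> = x}" by auto
    then show "real (card {\<omega>\<in>\<Omega>. X \<omega> = x}) / real (card \<Omega>) =
        prob (X -` {x} \<inter> space (uniform_count_measure \<Omega>))"
      using assms by (simp add: space_uniform_count_measure measure_uniform_count_measure)
  qed auto
qed

text \<open>If \<open>Y\<close> determines \<open>X\<close>, the joint fibre of an outcome equals
  its \<open>Y\<close>-fibre, so every term of the entropy sum contains the logarithm of 1.\<close>

lemma cond_entropy_eq_0:
  assumes fin: "finite \<Omega>" "\<Omega> \<noteq> {}"
    and det: "\<And>\<omega> \<omega>'. \<omega> \<in> \<Omega> \<Longrightarrow> \<omega>' \<in> \<Omega> \<Longrightarrow> Y \<omega> = Y \<omega>' \<Longrightarrow> X \<omega> = X \<omega>'"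
  shows "cond_entropy (uniform_count_measure \<Omega>) X Y = 0"
proof -
  interpret information_space "uniform_count_measure \<Omega>" 2
    using fin by (rule information_space_uniform_count)
  have "{\<omega>'\<in>\<Omega>. X \<omega>' = X \<omega> \<and> Y \<omega>' = Y \<omega>} = {\<omega>'\<in>\<Omega>. Y \<omega>' = Y \<omega>}" if "\<omega> \<in> \<Omega>" for \<omega>
    using det that by blast
  then show ?thesis
    unfolding cond_entropy_def
    by (subst conditional_entropy_eq[OF simple_distributed_uniform_count[OF fin]
          simple_distributed_uniform_count[OF fin]])
       (auto simp: space_uniform_count_measure intro!: sum.neutral)
qed

text \<open>The hypothesis says that the joint counts depend on \<open>X\<close> only through its support
  given \<open>Z\<close>.\<close>

lemma cond_mutual_info_eq_0:
  assumes fin: "finite \<Omega>" "\<Omega> \<noteq> {}"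
    and count: "\<And>\<omega> \<omega>' y. \<omega> \<in> \<Omega> \<Longrightarrow> \<omega>' \<in> \<Omega> \<Longrightarrow> Z \<omega> = Z \<omega>' \<Longrightarrow>
      card {\<eta>\<in>\<Omega>. X \<eta> = X \<omega> \<and> Y \<eta> = y \<and> Z \<eta> = Z \<omega>} \<le> card {\<eta>\<in>\<Omega>. X \<eta> = X \<omega>' \<and> Y \<eta> = y \<and> Z \<eta> = Z \<omega>}"
  shows "cond_mutual_info (uniform_count_measure \<Omega>) X Y Z = 0"
proof -
  interpret information_space "uniform_count_measure \<Omega>" 2
    using fin by (rule information_space_uniform_count)
  let ?xyz = "\<lambda>x y z. card {\<eta>\<in>\<Omega>. X \<eta> = x \<and> Y \<eta> = y \<and> Z \<eta> = z}"
  let ?xz = "\<lambda>x z. card {\<eta>\<in>\<Omega>. X \<eta> = x \<and> Z \<eta> = z}"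
  let ?yz = "\<lambda>y z. card {\<eta>\<in>\<Omega>. Y \<eta> = y \<and> Z \<eta> = z}"
  let ?z = "\<lambda>z. card {\<eta>\<in>\<Omega>. Z \<eta> = z}"
  \<comment> \<open>Conditional independence as a cross-multiplied identity of counts. Within a
    fibre of \<open>Z\<close>, \<open>?xyz\<close> is the same for all values of \<open>X\<close>
    that occur. If there are \<open>v\<close> such values, then \<open>?z = v * ?xz\<close> and
    \<open>?yz = v * ?xyz\<close>, so both products agree.\<close>
  have indep: "?xyz (X \<omega>) (Y \<omega>) (Z \<omega>) * ?z (Z \<omega>) = ?xz (X \<omega>) (Z \<omega>) * ?yz (Y \<omega>) (Z \<omega>)"
    if \<omega>: "\<omega> \<in> \<Omega>" for \<omega>
  proof -
    define A where "A = {\<eta>\<in>\<Omega>. Z \<eta> = Z \<omega>}"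
    have finA: "finite A" using fin by (simp add: A_def)
    have eq: "?xyz x y (Z \<omega>) = ?xyz (X \<omega>) y (Z \<omega>)" if "x \<in> X ` A" for x y
    proof -
      obtain \<omega>' where \<omega>': "\<omega>' \<in> \<Omega>" "Z \<omega>' = Z \<omega>" "x = X \<omega>'"
        using \<open>x \<in> X ` A\<close> unfolding A_def by blast
      \<comment> \<open>The hypothesis is an inequality, but it applies with the two outcomes
        exchanged as well. An injection between fibres is therefore all that privacy has to
        supply.\<close>
      show ?thesis
        using count[OF \<omega> \<omega>'(1) \<omega>'(2)[symmetric], of y] count[OF \<omega>'(1) \<omega> \<omega>'(2), of y]
        unfolding \<omega>' by (rule antisym[rotated])
    qed
    have fibres: "card {\<eta>\<in>A. Q \<eta>} = (\<Sum>v\<in>g ` A. card {\<eta>\<in>A. Q \<eta> \<and> g \<eta> = v})" for Q and g :: "'a \<Rightarrow> 'w"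
    proof -
      have "g ` {\<eta>\<in>A. Q \<eta>} \<subseteq> g ` A" by auto
      then show ?thesis
        using sum.group[of "{\<eta>\<in>A. Q \<eta>}" "g ` A" g "\<lambda>_. 1::nat"] finA
        by (simp add: conj_assoc)
    qed
    have xz: "?xz x (Z \<omega>) = (\<Sum>y\<in>Y ` A. ?xyz x y (Z \<omega>))" for x
      using fibres[of "\<lambda>\<eta>. X \<eta> = x" Y] by (simp add: A_def conj_ac)
    have yz: "?yz y (Z \<omega>) = (\<Sum>x\<in>X ` A. ?xyz x y (Z \<omega>))" for y
      using fibres[of "\<lambda>\<eta>. Y \<eta> = y" X] by (simp add: A_def conj_ac)
    have z: "?z (Z \<omega>) = (\<Sum>x\<in>X ` A. ?xz x (Z \<omega>))"
      using fibres[of "\<lambda>\<eta>. True" X] by (simp add: A_def conj_ac)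
    have xz': "?xz x (Z \<omega>) = ?xz (X \<omega>) (Z \<omega>)" if "x \<in> X ` A" for x
      unfolding xz[of x] xz[of "X \<omega>"] by (intro sum.cong refl eq that)
    have "?z (Z \<omega>) = (\<Sum>x\<in>X ` A. ?xz (X \<omega>) (Z \<omega>))"
      unfolding z by (intro sum.cong refl xz')
    moreover have "?yz (Y \<omega>) (Z \<omega>) = (\<Sum>x\<in>X ` A. ?xyz (X \<omega>) (Y \<omega>) (Z \<omega>))"
      unfolding yz by (intro sum.cong refl eq)
    ultimately show ?thesis by (simp only: sum_constant of_nat_id mult_ac)
  qed
  \<comment> \<open>The argument of the logarithm in conditional mutual information:
    \<open>c\<close> is the number of outcomes, and \<open>a\<close>, \<open>b\<close>,
    \<open>d\<close>, \<open>e\<close> are the counts for \<open>(X, Y, Z)\<close>,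
    \<open>(X, Z)\<close>, \<open>(Y, Z)\<close> and \<open>Z\<close>.\<close>
  have 1: "a / c / ((b / c) * (d / c / (e / c))) = 1"
    if "a * e = b * d" "a > 0" "c > 0" "b > 0" "d > 0" "e > 0" for a b c d e :: real
    using that by (simp add: field_simps)
  have pos: "0 < real (card {\<eta>\<in>\<Omega>. Q \<eta>})" if "\<omega> \<in> \<Omega>" "Q \<omega>" for Q \<omega>
    using that fin by (auto simp: card_gt_0_iff)
  have "real (?xyz (X \<omega>) (Y \<omega>) (Z \<omega>)) / card \<Omega> / ((?xz (X \<omega>) (Z \<omega>) / card \<Omega>) *
      (?yz (Y \<omega>) (Z \<omega>) / card \<Omega> / (?z (Z \<omega>) / card \<Omega>))) = 1" if \<omega>: "\<omega> \<in> \<Omega>" for \<omega>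
  proof (rule 1)
    show "real (?xyz (X \<omega>) (Y \<omega>) (Z \<omega>)) * real (?z (Z \<omega>)) = real (?xz (X \<omega>) (Z \<omega>)) * real (?yz (Y \<omega>) (Z \<omega>))"
      by (simp only: of_nat_mult[symmetric] indep[OF \<omega>])
    show "0 < real (card \<Omega>)"
      using fin by (simp add: card_gt_0_iff)
  qed (rule pos[OF \<omega>]; simp)+
  then have log0: "log 2 (real (?xyz (X \<omega>) (Y \<omega>) (Z \<omega>)) / card \<Omega> / ((?xz (X \<omega>) (Z \<omega>) / card \<Omega>) *
      (?yz (Y \<omega>) (Z \<omega>) / card \<Omega> / (?z (Z \<omega>) / card \<Omega>)))) = 0" if "\<omega> \<in> \<Omega>" for \<omega>
    using that by (simp only: log_one)
  show ?thesis
    unfolding cond_mutual_info_def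
    unfolding conditional_mutual_information_eq[OF simple_distributed_uniform_count[OF fin, of Z]
          simple_distributed_uniform_count[OF fin, of "\<lambda>\<omega>. (Y \<omega>, Z \<omega>)"]
          simple_distributed_uniform_count[OF fin, of "\<lambda>\<omega>. (X \<omega>, Z \<omega>)"]
          simple_distributed_uniform_count[OF fin, of "\<lambda>\<omega>. (X \<omega>, Y \<omega>, Z \<omega>)"]]
  proof (rule sum.neutral, rule ballI, elim imageE, hypsubst, unfold prod.case prod.inject)
    fix \<omega> assume "\<omega> \<in> space (uniform_count_measure \<Omega>)"
    then have "\<omega> \<in> \<Omega>" by (simp add: space_uniform_count_measure)
    from log0[OF this]
    show "real (?xyz (X \<omega>) (Y \<omega>) (Z \<omega>)) / card \<Omega> * log 2 (real (?xyz (X \<omega>) (Y \<omega>) (Z \<omega>)) / card \<Omega> / ((?xz (X \<omega>) (Z \<omega>) / card \<Omega>) *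
      (?yz (Y \<omega>) (Z \<omega>) / card \<Omega> / (?z (Z \<omega>) / card \<Omega>)))) = 0"
      by (simp only: mult_zero_right)
  qed
qed

section \<open>Hall's theorem and Baranyai's theorem\<close>

text \<open>Induction on the size of \<open>I\<close> in the style of Halmos and Vaughan. If a
  proper nonempty \<open>J\<close> is tight, it is matched inside its neighbourhood and the rest
  outside. Otherwise every proper nonempty subfamily has a value to spare, so one index can be
  matched arbitrarily and its value removed.\<close>

lemma hall_marriage:
  fixes A :: "'i \<Rightarrow> 'a set"
  assumes "finite I" "\<And>i. i \<in> I \<Longrightarrow> finite (A i)"
    and "\<And>J. J \<subseteq> I \<Longrightarrow> card J \<le> card (\<Union>i\<in>J. A i)"
  shows "\<exists>f. inj_on f I \<and> (\<forall>i\<in>I. f i \<in> A i)"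
  using assms
proof (induction "card I" arbitrary: I A rule: less_induct)
  case less
  have finN: "finite (\<Union>i\<in>J. A i)" if "J \<subseteq> I" for J
    using less.prems(1,2) that by (meson finite_UN_I finite_subset subsetD)
  consider "I = {}"
    | J where "J \<subset> I" "J \<noteq> {}" "card (\<Union>i\<in>J. A i) = card J"
    | "I \<noteq> {}" "\<And>J. J \<subset> I \<Longrightarrow> J \<noteq> {} \<Longrightarrow> card J < card (\<Union>i\<in>J. A i)"
    using less.prems(3) by (metis le_neq_implies_less psubset_imp_subset)
  then show ?case
  proof cases
    case 1
    then show ?thesis by auto
  next
    case (2 J)
    let ?N = "\<Union>i\<in>J. A i"
    have finJ: "finite J" using 2(1) less.prems(1) by (meson finite_subset psubset_imp_subset)
    have "\<exists>f. inj_on f J \<and> (\<forall>i\<in>J. f i \<in> A i)"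
      using 2(1) less.prems finJ by (intro less.hyps psubset_card_mono) auto
    then obtain f where f: "inj_on f J" "\<And>i. i \<in> J \<Longrightarrow> f i \<in> A i" by auto
    \<comment> \<open>Adjoining \<open>J\<close> to a violating \<open>L\<close> would violate
      Hall's condition in \<open>I\<close>, because \<open>J\<close> has exactly
      \<open>card J\<close> neighbours.\<close>
    have "card L \<le> card (\<Union>i\<in>L. A i - ?N)" if L: "L \<subseteq> I - J" for L
    proof -
      have finL: "finite L" using L less.prems(1) by (meson Diff_subset finite_subset)
      have "card L + card J = card (L \<union> J)"
        using L finL finJ by (subst card_Un_disjoint) auto
      also have "\<dots> \<le> card (\<Union>i\<in>L \<union> J. A i)"
        using L 2(1) by (intro less.prems(3)) auto
      also have "(\<Union>i\<in>L \<union> J. A i) = (\<Union>i\<in>L. A i - ?N) \<union> ?N" by auto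
      also have "card \<dots> = card (\<Union>i\<in>L. A i - ?N) + card ?N"
        using finN[of L] finN[of J] L 2(1) by (intro card_Un_disjoint) (auto intro: finite_subset)
      finally show ?thesis using 2(3) by simp
    qed
    then have "\<exists>g. inj_on g (I - J) \<and> (\<forall>i\<in>I - J. g i \<in> A i - ?N)"
      using 2 less.prems(1,2) by (intro less.hyps psubset_card_mono) auto
    then obtain g where g: "inj_on g (I - J)" "\<And>i. i \<in> I - J \<Longrightarrow> g i \<in> A i - ?N" by auto
    let ?h = "\<lambda>i. if i \<in> J then f i else g i"
    have "inj_on ?h I"
      using f g unfolding inj_on_def by (metis DiffI DiffD2 UN_I)
    moreover have "\<forall>i\<in>I. ?h i \<in> A i"
      using f g by auto
    ultimately show ?thesis by blast
  next
    case 3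
    then obtain i where i: "i \<in> I" by blast
    have "card {i} \<le> card (A i)" using less.prems(3)[of "{i}"] i by simp
    then obtain a where a: "a \<in> A i" by fastforce
    have "card J \<le> card (\<Union>j\<in>J. A j - {a})" if J: "J \<subseteq> I - {i}" for J
    proof (cases "J = {}")
      case False
      have "card J < card (\<Union>j\<in>J. A j)" using 3(2)[of J] J i False by blast
      moreover have "(\<Union>j\<in>J. A j - {a}) = (\<Union>j\<in>J. A j) - {a}" by auto
      moreover have "card (\<Union>j\<in>J. A j) - 1 \<le> card ((\<Union>j\<in>J. A j) - {a})"
        by (cases "a \<in> (\<Union>j\<in>J. A j)") (simp_all add: card_Diff_singleton_if)
      ultimately show ?thesis by simp
    qed auto
    then have "\<exists>g. inj_on g (I - {i}) \<and> (\<forall>j\<in>I - {i}. g j \<in> A j - {a})"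
      using i less.prems(1,2) by (intro less.hyps psubset_card_mono) auto
    then obtain g where g: "inj_on g (I - {i})" "\<And>j. j \<in> I - {i} \<Longrightarrow> g j \<in> A j - {a}" by auto
    have "inj_on (g(i := a)) I"
      using g unfolding inj_on_def by (metis DiffI DiffD2 fun_upd_apply singletonD singletonI)
    moreover have "\<forall>j\<in>I. (g(i := a)) j \<in> A j"
      using g a by auto
    ultimately show ?thesis by blast
  qed
qed

text \<open>Each value \<open>a\<close> is replaced by \<open>c a\<close> copies; a choice of
  distinct copies, projected back, uses \<open>a\<close> at most \<open>c a\<close> times.\<close>

lemma hall_capacity:
  fixes A :: "'i \<Rightarrow> 'a set" and c :: "'a \<Rightarrow> nat"
  assumes "finite I" "\<And>i. i \<in> I \<Longrightarrow> finite (A i)"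
    and hall: "\<And>J. J \<subseteq> I \<Longrightarrow> card J \<le> (\<Sum>a\<in>(\<Union>i\<in>J. A i). c a)"
  shows "\<exists>f. (\<forall>i\<in>I. f i \<in> A i) \<and> (\<forall>a. card {i\<in>I. f i = a} \<le> c a)"
proof -
  define A' where "A' i = Sigma (A i) (\<lambda>a. {..<c a})" for i
  have "card J \<le> card (\<Union>i\<in>J. A' i)" if "J \<subseteq> I" for J
  proof -
    have "(\<Union>i\<in>J. A' i) = Sigma (\<Union>i\<in>J. A i) (\<lambda>a. {..<c a})"
      by (auto simp: A'_def)
    moreover have "finite (\<Union>i\<in>J. A i)"
      using that assms(1,2) by (meson finite_UN_I finite_subset subsetD)
    ultimately show ?thesis using hall[OF that] by simp
  qed
  then have "\<exists>f. inj_on f I \<and> (\<forall>i\<in>I. f i \<in> A' i)"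
    using assms(1,2) by (intro hall_marriage) (auto simp: A'_def)
  then obtain f where f: "inj_on f I" "\<And>i. i \<in> I \<Longrightarrow> f i \<in> A' i" by auto
  have "card {i\<in>I. fst (f i) = a} \<le> c a" for a
  proof -
    have "f i \<in> {a} \<times> {..<c a}" if "i \<in> I" "fst (f i) = a" for i
      using f(2)[OF that(1)] that(2) by (cases "f i") (auto simp: A'_def)
    then have "f ` {i\<in>I. fst (f i) = a} \<subseteq> {a} \<times> {..<c a}" by blast
    moreover have "inj_on f {i\<in>I. fst (f i) = a}" using f(1) by (rule inj_on_subset) auto
    ultimately have "card {i\<in>I. fst (f i) = a} \<le> card ({a} \<times> {..<c a})"
      by (intro card_inj_on_le[of f]) auto
    then show ?thesis by simp
  qed
  moreover have "\<forall>i\<in>I. fst (f i) \<in> A i"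
    using f(2) unfolding A'_def by (metis mem_Sigma_iff prod.collapse)
  ultimately show ?thesis by (intro exI[of _ "fst \<circ> f"]) auto
qed

text \<open>The Brouwer--Schrijver induction: \<open>a i x\<close> is the block of the \<open>i\<close>-th partition that contains
  the point \<open>x\<close>, blocks may be empty, and points are added one at a time. Giving the pair of the
  \<open>i\<close>-th partition and its block \<open>S\<close> the weight \<open>(r - card S) / (n - l)\<close> is a fractional choice of the
  block receiving the new point, so Hall's condition holds for an integral choice.\<close>

lemma baranyai_partial:
  fixes r m l :: nat
  defines "n \<equiv> r * m" and "M \<equiv> (r * m - 1) choose (r - 1)"
  assumes r: "0 < r" and l: "l \<le> n"
  shows "\<exists>a :: nat \<Rightarrow> nat \<Rightarrow> nat. (\<forall>i<M. \<forall>x<l. a i x < m) \<and>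
    (\<forall>S\<subseteq>{..<l}. card {(i, b). i < M \<and> b < m \<and> {x. x < l \<and> a i x = b} = S} =
      (if card S \<le> r then (n - l) choose (r - card S) else 0))"
  using l
proof (induction l)
  case 0
  \<comment> \<open>Before any point is placed, all \<open>M * m\<close> blocks are empty, and their
    number is \<open>n choose r\<close> by the absorption identity.\<close>
  have "{(i, b). i < M \<and> b < m \<and> {x. x < (0::nat) \<and> 0 = b} = {}} = {..<M} \<times> {..<m}"
    by auto
  moreover have "r * (n choose r) = r * (m * M)"
    using times_binomial_minus1_eq[OF r, of n] by (simp add: n_def M_def mult_ac)
  ultimately show ?case
    using r by (intro exI[of _ "\<lambda>_ _. 0"]) simp
next
  case (Suc l)
  then obtain a where a: "\<And>i x. i < M \<Longrightarrow> x < l \<Longrightarrow> a i x < m"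
    and count: "\<And>S. S \<subseteq> {..<l} \<Longrightarrow>
      card {(i, b). i < M \<and> b < m \<and> {x. x < l \<and> a i x = b} = S} =
      (if card S \<le> r then (n - l) choose (r - card S) else 0)"
    by auto
  have ln: "l < n" using Suc.prems by simp
  define B where "B i b = {x. x < l \<and> a i x = b}" for i b
  \<comment> \<open>\<open>c S\<close> is the number of blocks with content \<open>S\<close> that
    have to receive the point \<open>l\<close>: it is the count that the claim demands for
    \<open>insert l S\<close> after this step.\<close>
  define c where "c S = (if card S < r then (n - Suc l) choose (r - card S - 1) else 0)" for S :: "nat set"
  define N where "N S = card {(i, b). i < M \<and> b < m \<and> B i b = S}" for S
  have finN: "finite {(i, b). i < M \<and> b < m \<and> Q i b}" for Q
    by (rule finite_subset[of _ "{..<M} \<times> {..<m}"]) auto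
  have N: "N S = (if card S \<le> r then (n - l) choose (r - card S) else 0)" if "S \<subseteq> {..<l}" for S
    using count[OF that] by (simp add: N_def B_def)
  have B_sub: "B i b \<subseteq> {..<l}" for i b by (auto simp: B_def)
  have card_B: "card (B i b) \<le> r" if "i < M" "b < m" for i b
  proof (rule ccontr)
    assume "\<not> card (B i b) \<le> r"
    then have "N (B i b) = 0" using N[OF B_sub] by simp
    then show False
      using that finN[of "\<lambda>i' b'. B i' b' = B i b"] by (auto simp: N_def)
  qed
  \<comment> \<open>Absorption identity: the blocks with content \<open>S\<close>, each weighted by
    the \<open>r - card S\<close> points it still lacks, weigh \<open>(n - l) * c S\<close> in
    total.\<close>
  have Nc: "N S * (r - card S) = (n - l) * c S" if "S \<subseteq> {..<l}" for S
  proof (cases "card S < r")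
    case True
    then show ?thesis
      using N[OF that] times_binomial_minus1_eq[of "r - card S" "n - l"]
      by (simp add: c_def mult.commute)
  next
    case False
    then show ?thesis using N[OF that] by (simp add: c_def)
  qed
  have weight: "(\<Sum>(i, b)\<in>{(i, b). i < M \<and> b < m \<and> B i b \<in> T}. r - card (B i b)) = (n - l) * sum c T"
    if T: "T \<subseteq> Pow {..<l}" for T
  proof -
    have finT: "finite T" using T by (rule finite_subset) simp
    have "(\<Sum>(i, b)\<in>{(i, b). i < M \<and> b < m \<and> B i b \<in> T}. r - card (B i b)) =
      (\<Sum>S\<in>T. \<Sum>p\<in>{p \<in> {(i, b). i < M \<and> b < m \<and> B i b \<in> T}. (case p of (i, b) \<Rightarrow> B i b) = S}.
        (case p of (i, b) \<Rightarrow> r - card (B i b)))"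
      using finT finN by (intro sum.group[symmetric]) auto
    also have "\<dots> = (\<Sum>S\<in>T. N S * (r - card S))"
    proof (rule sum.cong[OF refl])
      fix S assume S: "S \<in> T"
      have "(\<Sum>p\<in>{p \<in> {(i, b). i < M \<and> b < m \<and> B i b \<in> T}. (case p of (i, b) \<Rightarrow> B i b) = S}.
          (case p of (i, b) \<Rightarrow> r - card (B i b))) =
        (\<Sum>p\<in>{(i, b). i < M \<and> b < m \<and> B i b = S}. r - card S)"
        using S by (intro sum.cong) auto
      then show "(\<Sum>p\<in>{p \<in> {(i, b). i < M \<and> b < m \<and> B i b \<in> T}. (case p of (i, b) \<Rightarrow> B i b) = S}.
          (case p of (i, b) \<Rightarrow> r - card (B i b))) = N S * (r - card S)"
        by (simp add: N_def)
    qed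
    also have "\<dots> = (n - l) * sum c T"
      using T Nc by (simp add: sum_distrib_left subset_iff)
    finally show ?thesis .
  qed
  \<comment> \<open>The \<open>m\<close> blocks of a partition have final size \<open>r\<close>,
    which makes \<open>n\<close> points in all, and hold \<open>l\<close> so far;
    \<open>card_B\<close> keeps the truncated subtraction exact.\<close>
  have row: "(\<Sum>b<m. r - card (B i b)) = n - l" if i: "i < M" for i
  proof -
    have "(\<Sum>b<m. card (B i b)) = card (\<Union>b\<in>{..<m}. B i b)"
      by (subst card_UN_disjoint) (auto simp: B_def)
    also have "(\<Union>b\<in>{..<m}. B i b) = {..<l}"
      using a i by (auto simp: B_def)
    finally have "(\<Sum>b<m. card (B i b)) = l" by simp
    moreover have "(\<Sum>b<m. r - card (B i b)) = (\<Sum>b<m. r) - (\<Sum>b<m. card (B i b))"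
      using card_B i by (intro sum_subtractf_nat) auto
    ultimately show ?thesis by (simp add: n_def mult.commute)
  qed
  have rows: "card J * (n - l) = (\<Sum>(i, b)\<in>J \<times> {..<m}. r - card (B i b))" if "J \<subseteq> {..<M}" for J
    using that row by (subst sum.cartesian_product[symmetric]) (simp add: subset_iff)
  \<comment> \<open>Double counting of weight: the partitions in \<open>J\<close> contribute
    \<open>card J * (n - l)\<close>, while all blocks whose content occurs among them weigh
    \<open>(n - l) * sum c ?T\<close>. Cancelling \<open>n - l\<close> leaves Hall's
    condition.\<close>
  have "card J \<le> (\<Sum>S\<in>(\<Union>i\<in>J. B i ` {..<m}). c S)" if J: "J \<subseteq> {..<M}" for J
  proof -
    let ?T = "\<Union>i\<in>J. B i ` {..<m}"
    have "card J * (n - l) \<le> (\<Sum>(i, b)\<in>{(i, b). i < M \<and> b < m \<and> B i b \<in> ?T}. r - card (B i b))"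
      unfolding rows[OF J] using J by (intro sum_mono2 finN) auto
    also have "\<dots> = (n - l) * sum c ?T"
      using B_sub by (intro weight) auto
    finally show ?thesis using ln by (simp add: mult.commute)
  qed
  then have "\<exists>f. (\<forall>i\<in>{..<M}. f i \<in> B i ` {..<m}) \<and> (\<forall>S. card {i\<in>{..<M}. f i = S} \<le> c S)"
    by (intro hall_capacity) auto
  then obtain f where f: "\<And>i. i < M \<Longrightarrow> f i \<in> B i ` {..<m}"
    and f_le: "\<And>S. card {i\<in>{..<M}. f i = S} \<le> c S" by auto
  \<comment> \<open>The capacities add up to \<open>M\<close>, the number of partitions, so every
    bound in \<open>f_le\<close> is attained.\<close>
  have "f i \<in> Pow {..<l}" if "i < M" for i
    using f[OF that] B_sub by auto
  then have "(\<Sum>S\<in>Pow {..<l}. card {i\<in>{..<M}. f i = S}) = M"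
    using sum.group[of "{..<M}" "Pow {..<l}" f "\<lambda>_. 1::nat"] by (simp add: image_subset_iff)
  moreover have "{(i, b). i < M \<and> b < m \<and> B i b \<in> Pow {..<l}} = {..<M} \<times> {..<m}"
    using B_sub by auto
  then have "M * (n - l) = (n - l) * sum c (Pow {..<l})"
    using weight[of "Pow {..<l}"] rows[of "{..<M}"] by simp
  ultimately have total: "(\<Sum>S\<in>Pow {..<l}. card {i\<in>{..<M}. f i = S}) = sum c (Pow {..<l})"
    using ln by simp
  have f_eq: "card {i\<in>{..<M}. f i = S} = c S" if "S \<subseteq> {..<l}" for S
    using sum_mono_inv[OF total f_le, of S] that by simp
  \<comment> \<open>Blocks of one partition are disjoint, so only the empty content can occur
    several times; \<open>\<beta> i\<close> picks one block with the chosen content. This is why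
    pairs \<open>(i, b)\<close> are counted.\<close>
  have "\<forall>i. \<exists>b. i < M \<longrightarrow> b < m \<and> B i b = f i" using f by fastforce
  then obtain \<beta> where \<beta>: "\<And>i. i < M \<Longrightarrow> \<beta> i < m" "\<And>i. i < M \<Longrightarrow> B i (\<beta> i) = f i" by metis
  define a' where "a' i = (a i)(l := \<beta> i)" for i
  define B' where "B' i b = {x. x < Suc l \<and> a' i x = b}" for i b
  have B': "B' i b = (if b = \<beta> i then insert l (B i b) else B i b)" for i b
    by (auto simp: B'_def B_def a'_def)
  have l_notin: "l \<notin> B i b" for i b by (simp add: B_def)
  have "card {(i, b). i < M \<and> b < m \<and> B' i b = S} =
      (if card S \<le> r then (n - Suc l) choose (r - card S) else 0)" if S: "S \<subseteq> {..<Suc l}" for S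
  proof (cases "l \<in> S")
    case True
    have "{(i, b). i < M \<and> b < m \<and> B' i b = S} = (\<lambda>i. (i, \<beta> i)) ` {i\<in>{..<M}. f i = S - {l}}"
    proof -
      have "B' i b = S \<longleftrightarrow> b = \<beta> i \<and> f i = S - {l}" if "i < M" for i b
        using True l_notin[of i b] \<beta>(2)[OF that] unfolding B' by auto
      then show ?thesis using \<beta>(1) by auto
    qed
    then have "card {(i, b). i < M \<and> b < m \<and> B' i b = S} = card {i\<in>{..<M}. f i = S - {l}}"
      by (simp add: card_image inj_on_def)
    also have "\<dots> = c (S - {l})"
      using S by (intro f_eq) auto
    finally have "card {(i, b). i < M \<and> b < m \<and> B' i b = S} = c (S - {l})" .
    moreover have "card S = Suc (card (S - {l}))"
      using True S by (metis card.remove finite_lessThan finite_subset)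
    ultimately show ?thesis by (simp add: c_def Suc_le_eq)
  next
    case False
    then have Sl: "S \<subseteq> {..<l}" using S by (auto simp: less_Suc_eq)
    have "{(i, b). i < M \<and> b < m \<and> B' i b = S} =
      {(i, b). i < M \<and> b < m \<and> B i b = S} - (\<lambda>i. (i, \<beta> i)) ` {i\<in>{..<M}. f i = S}"
    proof -
      have eq: "B' i b = S \<longleftrightarrow> B i b = S \<and> \<not> (b = \<beta> i \<and> f i = S)" if "i < M" for i b
        using False \<beta>(2)[OF that] unfolding B' by auto
      have "{(i, b). i < M \<and> b < m \<and> B' i b = S} =
          {(i, b). i < M \<and> b < m \<and> B i b = S \<and> \<not> (b = \<beta> i \<and> f i = S)}"
        by (simp add: eq cong: conj_cong)
      also have "\<dots> = {(i, b). i < M \<and> b < m \<and> B i b = S} - {(i, b). i < M \<and> b = \<beta> i \<and> f i = S}"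
        by blast
      also have "{(i, b). i < M \<and> b = \<beta> i \<and> f i = S} = (\<lambda>i. (i, \<beta> i)) ` {i\<in>{..<M}. f i = S}"
        by blast
      finally show ?thesis .
    qed
    moreover have "(\<lambda>i. (i, \<beta> i)) ` {i\<in>{..<M}. f i = S} \<subseteq> {(i, b). i < M \<and> b < m \<and> B i b = S}"
      using \<beta> by auto
    ultimately have "card {(i, b). i < M \<and> b < m \<and> B' i b = S} =
      N S - card ((\<lambda>i. (i, \<beta> i)) ` {i\<in>{..<M}. f i = S})"
      by (simp add: N_def card_Diff_subset)
    also have "card ((\<lambda>i. (i, \<beta> i)) ` {i\<in>{..<M}. f i = S}) = c S"
      using f_eq[OF Sl] by (simp add: card_image inj_on_def)
    finally have *: "card {(i, b). i < M \<and> b < m \<and> B' i b = S} = N S - c S" .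
    show ?thesis
    proof (cases "card S < r")
      case True
      \<comment> \<open>Pascal's rule: of the \<open>N S\<close> blocks with content
        \<open>S\<close>, \<open>c S\<close> were extended, and
        \<open>(n - Suc l) choose (r - card S)\<close> remain.\<close>
      then obtain k where k: "r - card S = Suc k" by (metis Suc_pred zero_less_diff)
      have nl: "n - l = Suc (n - Suc l)" using ln by simp
      show ?thesis
        using True unfolding * N[OF Sl] c_def k nl by simp
    qed (auto simp: * N[OF Sl] c_def)
  qed
  moreover have "a' i x < m" if "i < M" "x < Suc l" for i x
    using a \<beta> that by (auto simp: a'_def less_Suc_eq)
  ultimately show ?case
    unfolding B'_def by (intro exI[of _ a']) blast
qed

text \<open>Once all points are placed, the count of \<open>baranyai_partial\<close> is 1 for sets
  of size \<open>r\<close> and 0 for all others. Each \<open>r\<close>-subset is thus a block of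
  exactly one partition, whose index is its colour; sets of one colour are blocks of one
  partition.\<close>

theorem baranyai:
  fixes r m :: nat
  assumes r: "0 < r"
  shows "\<exists>col. (\<forall>S. S \<subseteq> {..<r * m} \<longrightarrow> card S = r \<longrightarrow> col S < (r * m - 1) choose (r - 1)) \<and>
    (\<forall>S T. S \<subseteq> {..<r * m} \<longrightarrow> T \<subseteq> {..<r * m} \<longrightarrow> card S = r \<longrightarrow> card T = r \<longrightarrow>
      col S = col T \<longrightarrow> S \<noteq> T \<longrightarrow> S \<inter> T = {})"
proof -
  let ?n = "r * m" and ?M = "(r * m - 1) choose (r - 1)"
  obtain a :: "nat \<Rightarrow> nat \<Rightarrow> nat" where a: "\<forall>S\<subseteq>{..<?n}.
      card {(i, b). i < ?M \<and> b < m \<and> {x. x < ?n \<and> a i x = b} = S} =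
        (if card S \<le> r then (?n - ?n) choose (r - card S) else 0)"
    using baranyai_partial[OF r order_refl] by blast
  have count: "card {(i, b). i < ?M \<and> b < m \<and> {x. x < ?n \<and> a i x = b} = S} = 1"
    if "S \<subseteq> {..<?n}" "card S = r" for S
    unfolding a[rule_format, OF that(1)] using that(2) by simp
  have "\<exists>i. i < ?M \<and> (\<exists>b. {x. x < ?n \<and> a i x = b} = S)" if "S \<subseteq> {..<?n}" "card S = r" for S
  proof -
    have "{(i, b). i < ?M \<and> b < m \<and> {x. x < ?n \<and> a i x = b} = S} \<noteq> {}"
      using count[OF that] by (metis card.empty zero_neq_one)
    then show ?thesis by blast
  qed
  then obtain col where col: "\<And>S. S \<subseteq> {..<?n} \<Longrightarrow> card S = r \<Longrightarrow> col S < ?M"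
    "\<And>S. S \<subseteq> {..<?n} \<Longrightarrow> card S = r \<Longrightarrow> \<exists>b. {x. x < ?n \<and> a (col S) x = b} = S"
    by metis
  have "S \<inter> T = {}" if ST: "S \<subseteq> {..<?n}" "T \<subseteq> {..<?n}" "card S = r" "card T = r" "col S = col T" "S \<noteq> T" for S T
  proof -
    obtain b where b: "{x. x < ?n \<and> a (col S) x = b} = S"
      using col(2)[OF ST(1,3)] by blast
    obtain b' where b': "{x. x < ?n \<and> a (col S) x = b'} = T"
      using col(2)[OF ST(2,4)] ST(5) by auto
    then show ?thesis using b b' ST(6) by (cases "b = b'") (simp, force)
  qed
  with col(1) show ?thesis by blast
qed

section \<open>Combinatorics of secure placement delivery arrays\<close>

text \<open>The partial matching of \<open>g a\<close> with \<open>f a\<close> leaves complements of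
  equal size in \<open>C\<close>, and these can be matched arbitrarily. In the privacy proof
  \<open>C\<close> is the set of cached rows.\<close>

lemma permutes_extending:
  assumes "finite C" and f: "inj_on f A" "f ` A \<subseteq> C" and g: "inj_on g A" "g ` A \<subseteq> C"
  shows "\<exists>\<sigma>. \<sigma> permutes C \<and> (\<forall>a\<in>A. \<sigma> (g a) = f a)"
proof -
  have "card (g ` A) = card (f ` A)" using f(1) g(1) by (simp add: card_image)
  then have "card (C - g ` A) = card (C - f ` A)"
    using assms by (simp add: card_Diff_subset finite_subset)
  then obtain h where h: "bij_betw h (C - g ` A) (C - f ` A)"
    using \<open>finite C\<close> by (metis finite_Diff finite_same_card_bij)
  define \<sigma> where "\<sigma> x = (if x \<in> g ` A then f (inv_into A g x) else if x \<in> C then h x else x)" for x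
  have \<sigma>_g: "\<sigma> (g a) = f a" if "a \<in> A" for a
    using that g(1) by (simp add: \<sigma>_def)
  have "bij_betw \<sigma> (g ` A) (f ` A)"
    unfolding bij_betw_def
  proof
    show "inj_on \<sigma> (g ` A)" using f(1) by (auto simp: inj_on_def \<sigma>_g)
    show "\<sigma> ` g ` A = f ` A" by (auto simp: \<sigma>_g image_image)
  qed
  moreover have "bij_betw \<sigma> (C - g ` A) (C - f ` A)"
    using h by (subst bij_betw_cong[of _ _ h]) (auto simp: \<sigma>_def)
  ultimately have "bij_betw \<sigma> (g ` A \<union> (C - g ` A)) (f ` A \<union> (C - f ` A))"
    by (rule bij_betw_combine) auto
  then have "bij_betw \<sigma> C C" using f(2) g(2) by (simp add: Un_absorb1)
  moreover have "\<sigma> x = x" if "x \<notin> C" for x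
    using that g(2) by (auto simp: \<sigma>_def)
  ultimately have "\<sigma> permutes C" by (rule bij_imp_permutes)
  then show ?thesis using \<sigma>_g by blast
qed

text \<open>Condition (C3) freed from its permutations; \<open>q k\<close> is the row of the
  diagonal entry in column \<open>k\<close>. Four occurrences exclude \<open>g \<le> 1\<close>,
  where the subarray has at most two cells. With \<open>g \<ge> 2\<close> the constant row is the
  only one with two copies of \<open>s\<close>, which makes \<open>lead_row\<close> well
  defined.\<close>

lemma spda_symbol:
  assumes "spda K F Z S P" "s < S"
  shows "lead_row K F P s < F"
    and "\<exists>q. (\<forall>j<F. \<forall>k<K. P j k = Sym s \<longleftrightarrow>
            k \<in> cols_with K F P s \<and> (j = lead_row K F P s \<or> j = q k)) \<and>
          (\<forall>k\<in>cols_with K F P s. q k < F \<and> q k \<noteq> lead_row K F P s \<and>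
            (\<forall>l\<in>cols_with K F P s - {k}. P (q k) l = Star))"
proof -
  let ?R = "rows_with K F P s" and ?U = "cols_with K F P s"
  have "\<exists>(g::nat) r c. bij_betw r {..<g + 1} ?R \<and> bij_betw c {..<g} ?U \<and>
      (\<forall>l<g. P (r 0) (c l) = Sym s) \<and>
      (\<forall>i<g. \<forall>l<g. P (r (i + 1)) (c l) = (if i = l then Sym s else Star))"
    and four: "4 \<le> card {(j, k). j < F \<and> k < K \<and> P j k = Sym s}"
    using assms by (simp_all only: spda_def)
  then obtain g and r c :: "nat \<Rightarrow> nat" where
    r: "bij_betw r {..<g + 1} ?R" and c: "bij_betw c {..<g} ?U"
    and row0: "\<And>l. l < g \<Longrightarrow> P (r 0) (c l) = Sym s"
    and diag: "\<And>i l. i < g \<Longrightarrow> l < g \<Longrightarrow> P (r (Suc i)) (c l) = (if i = l then Sym s else Star)"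
    by (elim exE conjE) (rule that, assumption+, simp_all)
  have finR: "finite ?R" and finU: "finite ?U" by (simp_all add: rows_with_def cols_with_def)
  have cardR: "card ?R = g + 1" and cardU: "card ?U = g"
    using bij_betw_same_card[OF r] bij_betw_same_card[OF c] by simp_all
  have "card {(j, k). j < F \<and> k < K \<and> P j k = Sym s} \<le> card (?R \<times> ?U)"
    using finR finU by (intro card_mono) (auto simp: rows_with_def cols_with_def)
  then have g: "2 \<le> g"
    using four cardR cardU by (cases "g = 0 \<or> g = 1") (auto simp: card_cartesian_product)
  have r_img: "r ` {..<g + 1} = ?R" and c_img: "c ` {..<g} = ?U"
    using r c by (simp_all add: bij_betw_def)
  have r_inj: "r i = r j \<Longrightarrow> i < g + 1 \<Longrightarrow> j < g + 1 \<Longrightarrow> i = j" for i j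
    using r by (auto simp: bij_betw_def inj_on_def)
  have c_inj: "c i = c j \<Longrightarrow> i < g \<Longrightarrow> j < g \<Longrightarrow> i = j" for i j
    using c by (auto simp: bij_betw_def inj_on_def)
  have rF: "r i < F" if "i < g + 1" for i
    using that r_img by (auto simp: rows_with_def)
  have cK: "c l < K" if "l < g" for l
    using that c_img by (auto simp: cols_with_def)
  have occurs: "P j k = Sym s \<longleftrightarrow> (\<exists>l<g. k = c l \<and> (j = r 0 \<or> j = r (l + 1)))"
    if jk: "j < F" "k < K" for j k
  proof
    assume eq: "P j k = Sym s"
    then have "j \<in> ?R" "k \<in> ?U" using jk by (auto simp: rows_with_def cols_with_def)
    then obtain i l where i: "j = r i" "i < g + 1" and l: "k = c l" "l < g"
      using r_img c_img by (metis imageE lessThan_iff)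
    show "\<exists>l<g. k = c l \<and> (j = r 0 \<or> j = r (l + 1))"
    proof (cases i)
      case (Suc i')
      then have "i' = l" using diag[of i' l] eq i l by (auto split: if_splits)
      then show ?thesis using i l Suc by auto
    qed (use i l in auto)
  qed (auto simp: row0 diag)
  have lead: "lead_row K F P s = r 0"
    unfolding lead_row_def
  proof (rule the_equality)
    have "{k. k < K \<and> P (r 0) k = Sym s} = ?U"
      using occurs rF[of 0] cK unfolding c_img[symmetric] by auto
    then show "r 0 < F \<and> 2 \<le> card {k. k < K \<and> P (r 0) k = Sym s}"
      using rF[of 0] g cardU by simp
  next
    fix j assume j: "j < F \<and> 2 \<le> card {k. k < K \<and> P j k = Sym s}"
    show "j = r 0"
    proof (rule ccontr)
      assume "j \<noteq> r 0"
      then have *: "k < K \<Longrightarrow> P j k = Sym s \<Longrightarrow> \<exists>l<g. k = c l \<and> j = r (l + 1)" for k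
        using occurs j by blast
      have "k = k'" if "k < K \<and> P j k = Sym s" "k' < K \<and> P j k' = Sym s" for k k'
        using *[of k] *[of k'] that r_inj by fastforce
      then have "card {k. k < K \<and> P j k = Sym s} \<le> 1"
        by (simp add: card_le_Suc0_iff_eq)
      then show False using j by simp
    qed
  qed
  let ?q = "\<lambda>k. r (inv_into {..<g} c k + 1)"
  have inv_c: "inv_into {..<g} c (c l) = l" if "l < g" for l
    using c that by (simp add: bij_betw_def)
  show "lead_row K F P s < F" using rF lead by simp
  have "P j k = Sym s \<longleftrightarrow> k \<in> ?U \<and> (j = r 0 \<or> j = ?q k)" if "j < F" "k < K" for j k
    unfolding occurs[OF that] c_img[symmetric] using inv_c by auto
  moreover have "?q k < F \<and> ?q k \<noteq> r 0" if "k \<in> ?U" for k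
    using that rF r_inj unfolding c_img[symmetric] by (fastforce simp: inv_c)
  moreover have "P (?q k) l = Star" if "k \<in> ?U" "l \<in> ?U" "k \<noteq> l" for k l
    using that diag unfolding c_img[symmetric] by (auto simp: inv_c)
  ultimately show "\<exists>q. (\<forall>j<F. \<forall>k<K. P j k = Sym s \<longleftrightarrow>
            k \<in> ?U \<and> (j = lead_row K F P s \<or> j = q k)) \<and>
          (\<forall>k\<in>?U. q k < F \<and> q k \<noteq> lead_row K F P s \<and>
            (\<forall>l\<in>?U - {k}. P (q k) l = Star))"
    unfolding lead by (intro exI[of _ ?q]) auto
qed

locale secure_array =
  fixes K F Z S :: nat and P :: spda_array
  assumes spda: "spda K F Z S P" and S_pos: "0 < S"
begin

abbreviation lead :: "nat \<Rightarrow> nat" where "lead s \<equiv> lead_row K F P s"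
abbreviation users :: "nat \<Rightarrow> nat set" where "users s \<equiv> cols_with K F P s"
abbreviation syms :: "nat \<Rightarrow> nat set" where "syms k \<equiv> syms_of K F S P k"

text \<open>For \<open>k\<close> in \<open>users s\<close> this is the row of the diagonal entry:
  the packet of the requested file that user \<open>k\<close> lacks and obtains from message
  \<open>s\<close>.\<close>

definition tail_row :: "nat \<Rightarrow> nat \<Rightarrow> nat" where
  "tail_row s k = (THE j. j < F \<and> j \<noteq> lead s \<and> P j k = Sym s)"

lemma users_less: "k \<in> users s \<Longrightarrow> k < K"
  by (simp add: cols_with_def)

lemma finite_users: "finite (users s)"
  by (simp add: cols_with_def)

lemma finite_syms: "finite (syms k)"
  by (simp add: syms_of_def)

lemma symsD: "s \<in> syms k \<Longrightarrow> s < S" "s \<in> syms k \<Longrightarrow> k \<in> users s"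
  by (simp_all add: syms_of_def)

lemma lead_less: "s < S \<Longrightarrow> lead s < F"
  using spda_symbol(1)[OF spda] .

lemma tail_row:
  assumes s: "s < S"
  shows "\<And>j k. j < F \<Longrightarrow> k < K \<Longrightarrow>
      P j k = Sym s \<longleftrightarrow> k \<in> users s \<and> (j = lead s \<or> j = tail_row s k)"
    and "\<And>k. k \<in> users s \<Longrightarrow> tail_row s k < F"
    and "\<And>k. k \<in> users s \<Longrightarrow> tail_row s k \<noteq> lead s"
    and "\<And>k l. k \<in> users s \<Longrightarrow> l \<in> users s \<Longrightarrow> k \<noteq> l \<Longrightarrow> P (tail_row s k) l = Star"
proof -
  obtain q where occ: "\<And>j k. j < F \<Longrightarrow> k < K \<Longrightarrow>
      P j k = Sym s \<longleftrightarrow> k \<in> users s \<and> (j = lead s \<or> j = q k)"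
    and q: "\<And>k. k \<in> users s \<Longrightarrow> q k < F \<and> q k \<noteq> lead s"
    and star: "\<And>k l. k \<in> users s \<Longrightarrow> l \<in> users s \<Longrightarrow> k \<noteq> l \<Longrightarrow> P (q k) l = Star"
    using spda_symbol(2)[OF spda s] by auto
  have tail: "tail_row s k = q k" if "k \<in> users s" for k
    unfolding tail_row_def
    using that users_less[OF that] q[OF that] occ by (intro the_equality) auto
  show "P j k = Sym s \<longleftrightarrow> k \<in> users s \<and> (j = lead s \<or> j = tail_row s k)" if "j < F" "k < K" for j k
    using occ[OF that] tail[of k] by auto
  show "tail_row s k < F" "tail_row s k \<noteq> lead s" if "k \<in> users s" for k
    using q[OF that] tail[OF that] by simp_all
  show "P (tail_row s k) l = Star" if "k \<in> users s" "l \<in> users s" "k \<noteq> l" for k l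
    using star[OF that] tail[OF that(1)] by simp
qed

lemma P_lead: "s < S \<Longrightarrow> k \<in> users s \<Longrightarrow> P (lead s) k = Sym s"
  using tail_row(1)[of s "lead s" k] lead_less users_less by blast

lemma P_tail: "s < S \<Longrightarrow> k \<in> users s \<Longrightarrow> P (tail_row s k) k = Sym s"
  using tail_row(1)[of s "tail_row s k" k] tail_row(2) users_less by blast

lemma cells: "j < F \<Longrightarrow> k < K \<Longrightarrow> P j k = Star \<or> (\<exists>s<S. P j k = Sym s)"
  using spda by (simp add: spda_def)

definition cached_rows :: "nat \<Rightarrow> nat set" where
  "cached_rows k = {j. j < F \<and> P j k = Star} \<union> lead ` syms k"

lemma cached_rows_less: "j \<in> cached_rows k \<Longrightarrow> j < F"
  by (auto simp: cached_rows_def dest: symsD(1) intro: lead_less)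

lemma finite_cached_rows: "finite (cached_rows k)"
  by (rule finite_subset[of _ "{..<F}"]) (auto dest: cached_rows_less)

lemma inj_on_lead: "inj_on lead (syms k)"
  by (rule inj_onI) (metis P_lead spda_entry.inject symsD)

lemma tail_notin_cached:
  assumes "s \<in> syms k" shows "tail_row s k \<notin> cached_rows k"
proof
  assume "tail_row s k \<in> cached_rows k"
  moreover have P: "P (tail_row s k) k = Sym s" using assms P_tail symsD by blast
  ultimately obtain s' where s': "s' \<in> syms k" "tail_row s k = lead s'"
    by (auto simp: cached_rows_def)
  then have "s' = s" using P P_lead symsD by (metis spda_entry.inject)
  then show False using s' tail_row(3) symsD assms by metis
qed

lemma uncached_row:
  assumes "j < F" "k < K" "j \<notin> cached_rows k"
  obtains s where "s \<in> syms k" "j = tail_row s k"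
proof -
  from assms obtain s where s: "s < S" "P j k = Sym s"
    using cells[of j k] by (auto simp: cached_rows_def)
  then have *: "k \<in> users s" "j = lead s \<or> j = tail_row s k"
    using tail_row(1)[of s j k] assms by auto
  then have "s \<in> syms k" using s by (simp add: syms_of_def)
  then show thesis using that * assms(3) by (auto simp: cached_rows_def)
qed

text \<open>Besides the stars, column \<open>k\<close> contains each of its symbols exactly twice,
  once in the lead row, which is cached, and once in the tail row, which is not. The second equation
  allows the number of symbols to be computed from \<open>F\<close> and \<open>Z\<close>.\<close>

lemma card_cached_rows:
  assumes k: "k < K"
  shows "card (cached_rows k) = Z + card (syms k)"
    and "F = Z + 2 * card (syms k)"
proof -
  have Z: "card {j. j < F \<and> P j k = Star} = Z"
    using spda k by (simp add: spda_def)
  have "card (cached_rows k) = card {j. j < F \<and> P j k = Star} + card (lead ` syms k)"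
    unfolding cached_rows_def
    using P_lead symsD by (intro card_Un_disjoint) (auto simp: finite_syms)
  then show *: "card (cached_rows k) = Z + card (syms k)"
    using Z by (simp add: card_image inj_on_lead)
  have "{..<F} = cached_rows k \<union> (\<lambda>s. tail_row s k) ` syms k"
    using cached_rows_less tail_row(2) symsD uncached_row[OF _ k] by (auto, blast)
  moreover have "card (cached_rows k \<union> (\<lambda>s. tail_row s k) ` syms k) =
      card (cached_rows k) + card ((\<lambda>s. tail_row s k) ` syms k)"
    using tail_notin_cached by (intro card_Un_disjoint) (auto simp: finite_cached_rows finite_syms)
  moreover have "inj_on (\<lambda>s. tail_row s k) (syms k)"
    by (rule inj_onI) (metis P_tail spda_entry.inject symsD)
  ultimately have "card {..<F} = card (cached_rows k) + card (syms k)"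
    by (simp add: card_image)
  then show "F = Z + 2 * card (syms k)" using * by simp
qed

text \<open>By \<open>F = Z + 2 * card (syms k)\<close> all users have equally many symbols, and
  symbol 0 has a user. Decoding needs at least one message, since it is a header that reveals the
  own request.\<close>

lemma syms_nonempty:
  assumes k: "k < K" shows "syms k \<noteq> {}"
proof
  assume "syms k = {}"
  then have "F = Z" using card_cached_rows(2)[OF k] by simp
  have "0 < card {(j, k). j < F \<and> k < K \<and> P j k = Sym 0}"
    using spda S_pos unfolding spda_def by fastforce
  then obtain l where l: "l < K" "0 \<in> syms l"
    using S_pos by (fastforce simp: card_gt_0_iff syms_of_def cols_with_def)
  then have "0 < card (syms l)" using finite_syms by (auto simp: card_gt_0_iff)
  then show False using card_cached_rows(2)[OF l(1)] \<open>F = Z\<close> by simp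
qed

text \<open>The row from which \<open>X\<^bsub>\<U>\<^sub>s\<^esub>\<close> takes a packet of file \<open>n\<close>; it takes exactly one from every file.\<close>

definition src_row :: "(nat \<Rightarrow> nat) \<Rightarrow> nat \<Rightarrow> nat \<Rightarrow> nat" where
  "src_row d s n = (if n \<in> d ` users s then tail_row s (inv_into (users s) d n) else lead s)"

lemma src_row_demanded:
  assumes "inj_on d (users s)" "k \<in> users s"
  shows "src_row d s (d k) = tail_row s k"
  using assms by (simp add: src_row_def)

text \<open>A file requested by another member of the group is read in an off-diagonal row of the
  subarray, where column \<open>k\<close> has a star. A file requested by no member is read in the
  lead row, which is cached in addition to the stars.\<close>

lemma src_row_cached:
  assumes s: "s \<in> syms k" and n: "n \<noteq> d k"
  shows "src_row d s n \<in> cached_rows k"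
proof (cases "n \<in> d ` users s")
  case True
  let ?l = "inv_into (users s) d n"
  have l: "?l \<in> users s" "d ?l = n" using True by (simp_all add: inv_into_into f_inv_into_f)
  then have "P (tail_row s ?l) k = Star"
    using n s symsD by (intro tail_row(4)) auto
  then show ?thesis
    using True l(1) tail_row(2) symsD(1)[OF s] by (simp add: src_row_def cached_rows_def)
next
  case False
  then show ?thesis using s by (auto simp: src_row_def cached_rows_def)
qed

lemma src_row_less: "s < S \<Longrightarrow> src_row d s n < F"
  by (auto simp: src_row_def lead_less tail_row(2) inv_into_into)

lemma P_src_row:
  assumes s: "s \<in> syms k" and n: "n \<in> d ` users s" and d: "inj_on d {..<K}"
  shows "P (src_row d s n) (inv_into {..<K} d n) = Sym s"
proof -
  obtain l where l: "l \<in> users s" "n = d l" using n by blast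
  have "inv_into {..<K} d n = l" using l users_less d by simp
  moreover have "inj_on d (users s)" using d users_less by (auto intro: inj_on_subset)
  then have "src_row d s n = tail_row s l" using l src_row_demanded by simp
  ultimately show ?thesis using l(1) P_tail symsD(1)[OF s] by simp
qed

text \<open>This allows one rearrangement of file \<open>n\<close> to serve all messages of user
  \<open>k\<close>. If both groups contain the requester of \<open>n\<close>, the entry in the
  requester's column determines the symbol. If neither does, the entry in column \<open>k\<close> of
  the lead row does. In the mixed case column \<open>k\<close> would hold both a star and a symbol
  in the same row.\<close>

lemma inj_on_src_row:
  assumes d: "inj_on d {..<K}" and n: "n \<noteq> d k"
  shows "inj_on (\<lambda>s. src_row d s n) (syms k)"
proof -
  have neq: False if st: "s \<in> syms k" "t \<in> syms k" "n \<in> d ` users s" "n \<notin> d ` users t"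
    "src_row d s n = src_row d t n" for s t
  proof -
    obtain l where l: "l \<in> users s" "n = d l" using st(3) by blast
    have "inj_on d (users s)" using d users_less by (auto intro: inj_on_subset)
    then have "src_row d s n = tail_row s l" using l src_row_demanded by simp
    moreover have "P (tail_row s l) k = Star"
      using l n st(1) symsD by (intro tail_row(4)) auto
    moreover have "P (src_row d t n) k = Sym t"
      using st(2,4) P_lead symsD by (simp add: src_row_def)
    ultimately show False using st(5) by simp
  qed
  show ?thesis
  proof (rule inj_onI)
    fix s t assume st: "s \<in> syms k" "t \<in> syms k" "src_row d s n = src_row d t n"
    consider "n \<in> d ` users s" "n \<in> d ` users t" | "n \<notin> d ` users s" "n \<notin> d ` users t"
      using neq[OF st(1,2)] neq[OF st(2,1)] st(3) by metis
    then show "s = t"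
    proof cases
      case 1
      have "Sym s = Sym t"
        using P_src_row[OF st(1) 1(1) d, unfolded st(3)] P_src_row[OF st(2) 1(2) d] by (rule trans[OF sym])
      then show ?thesis by (rule spda_entry.inject[THEN iffD1])
    next
      case 2
      then show ?thesis using st inj_on_lead by (auto simp: src_row_def inj_on_def)
    qed
  qed
qed

end

section \<open>Decodability\<close>

lemma finite_UNIV_bit: "finite (UNIV :: bit set)"
proof (rule finite_subset)
  show "(UNIV :: bit set) \<subseteq> {0, 1}" using bit.exhaust by auto
qed simp

lemma finite_bitstrings: "finite (bitstrings L)"
  using finite_lists_length_eq[OF finite_UNIV_bit, of L] by (simp add: bitstrings_def)

lemma finite_outcomes: "finite (outcomes K F S N B)"
  unfolding outcomes_def
  by (intro finite_cartesian_product finite_PiE finite_bitstrings finite_permutations)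
     (auto intro!: finite_PiE)

lemma outcomes_nonempty:
  assumes "K \<le> N" shows "outcomes K F S N B \<noteq> {}"
proof -
  have "replicate L 0 \<in> bitstrings L" for L by (simp add: bitstrings_def)
  then have bits: "{..<m} \<rightarrow>\<^sub>E bitstrings L \<noteq> {}" for m :: nat and L
    by (auto simp: PiE_eq_empty_iff)
  have "restrict id {..<K} \<in> {d \<in> {..<K} \<rightarrow>\<^sub>E {..<N}. inj_on d {..<K}}"
    using assms by (auto simp: inj_on_def)
  moreover have "{..<N} \<rightarrow>\<^sub>E {\<pi>. \<pi> permutes {..<F}} \<noteq> {}"
    using permutes_id[of "{..<F}"] by (auto simp: PiE_eq_empty_iff simp del: permutes_id)
  ultimately show ?thesis
    using bits[of N B] bits[of S "B div F"] unfolding outcomes_def Times_empty by blast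
qed

lemma outcomesD:
  assumes "(W, d, \<phi>, T) \<in> outcomes K F S N B"
  shows "\<And>n. n < N \<Longrightarrow> length (W n) = B" "inj_on d {..<K}" "\<And>k. k < K \<Longrightarrow> d k < N"
    "\<And>n. n < N \<Longrightarrow> \<phi> n permutes {..<F}" "\<And>s. s < S \<Longrightarrow> length (T s) = B div F"
  using assms by (auto simp: outcomes_def bitstrings_def PiE_iff)

section \<open>Packets and exclusive-or sums\<close>

lemma packet_index_less:
  fixes i j L F :: nat
  assumes "i < L" "j < F" shows "j * L + i < F * L"
proof -
  have "j * L + i < Suc j * L" using assms(1) by simp
  also have "\<dots> \<le> F * L" using assms(2) by (intro mult_le_mono1) simp
  finally show ?thesis .
qed

lemma packet_nth:
  assumes "length w = B" "F dvd B" "j < F" "i < B div F"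
  shows "length (packet B F w j) = B div F" "packet B F w j ! i = w ! (j * (B div F) + i)"
proof -
  have "j * (B div F) + (B div F) \<le> F * (B div F)"
    using mult_le_mono1[of "Suc j" F "B div F"] assms(3) by simp
  also have "\<dots> = B" using assms(2) by simp
  finally show "length (packet B F w j) = B div F" "packet B F w j ! i = w ! (j * (B div F) + i)"
    using assms by (simp_all add: packet_def split_file_def)
qed

lemma length_packet:
  assumes "length w = B" "F dvd B" "j < F" shows "length (packet B F w j) = B div F"
proof (cases "B div F = 0")
  case True
  then show ?thesis using assms by (simp add: packet_def split_file_def)
next
  case False
  then show ?thesis using packet_nth(1)[OF assms, of 0] by simp
qed

lemma packet_index:
  fixes i B F :: nat
  assumes "i < B" "F dvd B"
  shows "i div (B div F) < F" "i mod (B div F) < B div F"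
    "i div (B div F) * (B div F) + i mod (B div F) = i"
proof -
  have "B = F * (B div F)" using assms(2) by simp
  then show "i div (B div F) < F" using assms(1) by (metis less_mult_imp_div_less)
  show "i mod (B div F) < B div F"
    using assms \<open>B = F * (B div F)\<close> by (intro mod_less_divisor) (metis mult_0_right neq0_conv not_less0)
qed (rule div_mult_mod_eq)

lemma file_eqI:
  assumes "length v = B" "length w = B" "F dvd B"
    and eq: "\<And>j. j < F \<Longrightarrow> packet B F v j = packet B F w j"
  shows "v = w"
proof (rule nth_equalityI)
  show "length v = length w" using assms by simp
  fix i assume "i < length v"
  then have i: "i < B" using assms by simp
  note I = packet_index[OF i \<open>F dvd B\<close>]
  show "v ! i = w ! i"
    using packet_nth(2)[OF assms(1,3) I(1,2)] packet_nth(2)[OF assms(2,3) I(1,2)] eq[OF I(1)] I(3)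
    by simp
qed

text \<open>A bit index is split into packet number and offset, and only the packet number is moved:
  packet \<open>j\<close> of the result is packet \<open>\<sigma> j\<close> of
  \<open>w\<close>.\<close>

definition permute_packets :: "nat \<Rightarrow> nat \<Rightarrow> (nat \<Rightarrow> nat) \<Rightarrow> bit list \<Rightarrow> bit list" where
  "permute_packets B F \<sigma> w =
     map (\<lambda>i. w ! (\<sigma> (i div (B div F)) * (B div F) + i mod (B div F))) [0..<B]"

lemma length_permute_packets [simp]: "length (permute_packets B F \<sigma> w) = B"
  by (simp add: permute_packets_def)

lemma packet_permute_packets:
  assumes w: "length w = B" and F: "F dvd B" and j: "j < F" and \<sigma>: "\<sigma> j < F"
  shows "packet B F (permute_packets B F \<sigma> w) j = packet B F w (\<sigma> j)"
proof (rule nth_equalityI)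
  show "length (packet B F (permute_packets B F \<sigma> w) j) = length (packet B F w (\<sigma> j))"
    using assms by (simp add: length_packet)
  fix i assume "i < length (packet B F (permute_packets B F \<sigma> w) j)"
  then have i: "i < B div F" using assms by (simp add: length_packet)
  have "j * (B div F) + i < B"
    using packet_index_less[OF i j] F by simp
  moreover have "(j * (B div F) + i) div (B div F) = j" "(j * (B div F) + i) mod (B div F) = i"
    using i by simp_all
  ultimately have "permute_packets B F \<sigma> w ! (j * (B div F) + i) = w ! (\<sigma> j * (B div F) + i)"
    by (simp add: permute_packets_def)
  then show "packet B F (permute_packets B F \<sigma> w) j ! i = packet B F w (\<sigma> j) ! i"
    using assms i by (simp add: packet_nth(2))
qed

lemma length_xor_sum [simp]: "length (xor_sum L A f) = L"
  by (simp add: xor_sum_def)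

lemma nth_xor_sum [simp]: "i < L \<Longrightarrow> xor_sum L A f ! i = (\<Sum>x\<in>A. f x ! i)"
  by (simp add: xor_sum_def)

lemma length_xor [simp]: "length (xor v w) = min (length v) (length w)"
  by (simp add: xor_def)

lemma xor_xor_sum:
  assumes "finite A" "finite A'" "A \<inter> A' = {}"
  shows "xor (xor_sum L A f) (xor_sum L A' f) = xor_sum L (A \<union> A') f"
  using assms by (intro nth_equalityI) (simp_all add: xor_def sum.union_disjoint)

lemma xor_sum_reindex:
  assumes "inj_on h A" shows "xor_sum L (h ` A) f = xor_sum L A (\<lambda>x. f (h x))"
  using assms by (simp add: xor_sum_def sum.reindex)

lemma xor_sum_cong:
  assumes "\<And>x. x \<in> A \<Longrightarrow> f x = g x" shows "xor_sum L A f = xor_sum L A g"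
  unfolding xor_sum_def using assms by (intro map_cong refl sum.cong) simp_all

lemma xor_left_cancel:
  assumes "xor u v = xor u w" "length u = L" "length v = L" "length w = L" shows "v = w"
proof (rule nth_equalityI)
  fix i assume i: "i < length v"
  have "u ! i + v ! i = xor u v ! i" "u ! i + w ! i = xor u w ! i"
    unfolding xor_def using i assms(2-4) by (simp_all only: nth_map nth_zip length_zip min.idem prod.case)
  then have "u ! i + v ! i = u ! i + w ! i" using assms(1) by simp
  then show "v ! i = w ! i" by (rule add_left_imp_eq)
qed (use assms in simp)

lemma xor_sum_cancel:
  assumes "xor_sum L A f = xor_sum L A g" "finite A" "a \<in> A"
    and "\<And>x. x \<in> A \<Longrightarrow> x \<noteq> a \<Longrightarrow> f x = g x" "length (f a) = L" "length (g a) = L"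
  shows "f a = g a"
proof (rule nth_equalityI)
  fix i assume "i < length (f a)"
  then have i: "i < L" using assms by simp
  have "(\<Sum>x\<in>A. f x ! i) = (\<Sum>x\<in>A. g x ! i)"
    using arg_cong[OF assms(1), of "\<lambda>u. u ! i"] i by simp
  moreover have "(\<Sum>x\<in>A - {a}. f x ! i) = (\<Sum>x\<in>A - {a}. g x ! i)"
    using assms(4) by (intro sum.cong) auto
  ultimately have "f a ! i + (\<Sum>x\<in>A - {a}. g x ! i) = g a ! i + (\<Sum>x\<in>A - {a}. g x ! i)"
    unfolding sum.remove[OF assms(2,3)] by (simp only:)
  then show "f a ! i = g a ! i" by (rule add_right_imp_eq)
qed (use assms in simp)

locale caching_scheme = secure_array +
  fixes N B :: nat
  assumes K_le_N: "K \<le> N" and F_dvd_B: "F dvd B" and B_pos: "0 < B"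
begin

abbreviation \<Omega> where "\<Omega> \<equiv> outcomes K F S N B"

lemma demands_of_users:
  assumes "(W, d, \<phi>, T) \<in> \<Omega>"
  shows "inj_on d (users s)" "d ` users s \<subseteq> {..<N}"
  using outcomesD(2,3)[OF assms] users_less by (auto intro: inj_on_subset)

lemma demanded_cells_eq:
  assumes "s < S"
  shows "demanded_cells K F P s = (\<lambda>k. (k, tail_row s k)) ` users s"
  using tail_row[OF assms] users_less P_tail[OF assms] by (auto simp: demanded_cells_def)

text \<open>In this form requested and unrequested files are treated alike: one labelled packet per
  file, with the demands entering only through \<open>src_row\<close>. Messages for different demand
  vectors thereby become comparable file by file.\<close>

lemma header_eq:
  assumes \<omega>: "(W, d, \<phi>, T) \<in> \<Omega>" and s: "s < S"
  shows "header K F N P s (W, d, \<phi>, T) = (users s, (\<lambda>n. (n, \<phi> n (src_row d s n))) ` {..<N})"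
proof -
  have "{..<N} = d ` users s \<union> undemanded_files K F N P s d"
    using demands_of_users[OF \<omega>] by (auto simp: undemanded_files_def)
  then have "(\<lambda>n. (n, \<phi> n (src_row d s n))) ` {..<N} =
      (\<lambda>n. (n, \<phi> n (src_row d s n))) ` d ` users s \<union>
      (\<lambda>n. (n, \<phi> n (src_row d s n))) ` undemanded_files K F N P s d"
    by (simp only: image_Un)
  moreover have "(\<lambda>n. (n, \<phi> n (src_row d s n))) ` undemanded_files K F N P s d =
      (\<lambda>n. (n, \<phi> n (lead s))) ` undemanded_files K F N P s d"
    by (rule image_cong) (simp_all add: undemanded_files_def src_row_def)
  moreover have "(\<lambda>n. (n, \<phi> n (src_row d s n))) ` d ` users s =
      (\<lambda>(k, j). (d k, \<phi> (d k) j)) ` demanded_cells K F P s"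
    unfolding demanded_cells_eq[OF s] image_image
    by (rule image_cong) (simp_all add: src_row_demanded demands_of_users[OF \<omega>])
  ultimately show ?thesis by (simp add: header_def)
qed

lemma payload_eq:
  assumes \<omega>: "(W, d, \<phi>, T) \<in> \<Omega>" and s: "s < S"
  shows "payload K F N B P s (W, d, \<phi>, T) =
    xor_sum (B div F) {..<N} (\<lambda>n. packet B F (W n) (src_row d s n))"
proof -
  let ?f = "\<lambda>n. packet B F (W n) (src_row d s n)"
  have "xor_sum (B div F) (demanded_cells K F P s) (\<lambda>(k, j). packet B F (W (d k)) j) =
      xor_sum (B div F) (users s) (\<lambda>k. packet B F (W (d k)) (tail_row s k))"
    unfolding demanded_cells_eq[OF s] by (subst xor_sum_reindex) (simp_all add: inj_on_def)
  also have "\<dots> = xor_sum (B div F) (users s) (\<lambda>k. ?f (d k))"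
    by (rule xor_sum_cong) (simp add: src_row_demanded demands_of_users[OF \<omega>])
  also have "\<dots> = xor_sum (B div F) (d ` users s) ?f"
    by (rule xor_sum_reindex[symmetric]) (rule demands_of_users(1)[OF \<omega>])
  finally have 1: "xor_sum (B div F) (demanded_cells K F P s) (\<lambda>(k, j). packet B F (W (d k)) j) =
    xor_sum (B div F) (d ` users s) ?f" .
  have 2: "xor_sum (B div F) (undemanded_files K F N P s d) (\<lambda>n. packet B F (W n) (lead s)) =
      xor_sum (B div F) ({..<N} - d ` users s) ?f"
    unfolding undemanded_files_def by (rule xor_sum_cong) (simp add: src_row_def)
  have "payload K F N B P s (W, d, \<phi>, T) =
      xor_sum (B div F) (d ` users s \<union> ({..<N} - d ` users s)) ?f"
    unfolding payload_def prod.case 1 2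
    by (rule xor_xor_sum) (auto simp: finite_users)
  also have "d ` users s \<union> ({..<N} - d ` users s) = {..<N}"
    using demands_of_users(2)[OF \<omega>] by auto
  finally show ?thesis .
qed

lemma length_payload: "length (payload K F N B P s \<omega>) = B div F"
  by (cases \<omega>) (simp add: payload_def)

lemma cached_packets_eq:
  assumes k: "k < K"
  shows "cached_packets K F S N B P k (W, d, \<phi>, T) =
    {(n, \<phi> n j, packet B F (W n) j) | n j. n < N \<and> j \<in> cached_rows k}"
proof -
  have "P (lead s) k = Sym s \<longleftrightarrow> k \<in> users s" if "s < S" for s
    using tail_row(1)[OF that lead_less[OF that] k] by simp
  then have "lead ` syms k = {lead s | s. s < S \<and> P (lead s) k = Sym s}"
    by (auto simp: syms_of_def)
  then show ?thesis
    unfolding cached_packets_def cached_rows_def by auto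
qed

text \<open>Zero conditional entropy means that the observation determines the file, so two outcomes
  with equal observations are compared and no decoder is written down. The request
  \<open>d k\<close> is not part of the observation and has to be recovered as well.\<close>

lemma decode:
  assumes k: "k < K" and \<omega>: "\<omega> \<in> \<Omega>" and \<omega>': "\<omega>' \<in> \<Omega>"
    and cache: "cached_packets K F S N B P k \<omega> = cached_packets K F S N B P k \<omega>'"
    and keys: "cached_keys K F S P k \<omega> = cached_keys K F S P k \<omega>'"
    and bc: "broadcasts_for K F S N B P k \<omega> = broadcasts_for K F S N B P k \<omega>'"
    and perm: "private_permutation k \<omega> = private_permutation k \<omega>'"
  shows "requested_file k \<omega> = requested_file k \<omega>'"
proof -
  obtain W d \<phi> T where w: "\<omega> = (W, d, \<phi>, T)" by (cases \<omega>)
  obtain W' d' \<phi>' T' where w': "\<omega>' = (W', d', \<phi>', T')" by (cases \<omega>')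
  note O = outcomesD[OF \<omega>[unfolded w]] and O' = outcomesD[OF \<omega>'[unfolded w']]
  define n0 where "n0 = d k"
  have n0: "n0 < N" using O(3) k by (simp add: n0_def)
  have inj: "i = j" if "\<phi> n i = \<phi> n j" "n < N" for n i j
    using permutes_inj[OF O(4)[OF that(2)]] that(1) by (auto simp: inj_def)
  \<comment> \<open>Equal caches match packets only through their labels; the same packet may sit in
    different positions \<open>i\<close> and \<open>j\<close> of the two outcomes.\<close>
  have cached: "packet B F (W n) i = packet B F (W' n) j"
    if "n < N" "i \<in> cached_rows k" "j < F" "\<phi> n i = \<phi>' n j" for n i j
  proof -
    have "(n, \<phi> n i, packet B F (W n) i) \<in> cached_packets K F S N B P k \<omega>'"
      unfolding cache[symmetric] w cached_packets_eq[OF k] using that by blast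
    then obtain j' where j': "\<phi> n i = \<phi>' n j'" "packet B F (W n) i = packet B F (W' n) j'"
      unfolding w' cached_packets_eq[OF k] by blast
    have "j' = j"
      using permutes_inj[OF O'(4)[OF that(1)]] that(4) j'(1) by (auto simp: inj_def)
    then show ?thesis using j'(2) by simp
  qed
  have header: "\<phi> n (src_row d s n) = \<phi>' n (src_row d' s n)" if s: "s \<in> syms k" and n: "n < N" for s n
  proof -
    have "header K F N P s \<omega> = header K F N P s \<omega>'"
      using fun_cong[OF bc, of s] s by (simp add: broadcasts_for_def)
    then have "(\<lambda>n. (n, \<phi> n (src_row d s n))) ` {..<N} = (\<lambda>n. (n, \<phi>' n (src_row d' s n))) ` {..<N}"
      using header_eq[OF \<omega>[unfolded w] symsD(1)[OF s]] header_eq[OF \<omega>'[unfolded w'] symsD(1)[OF s]]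
      by (simp add: w w')
    then show ?thesis using n by (auto simp: image_iff set_eq_iff)
  qed
  have tail: "src_row d s n0 = tail_row s k" if "s \<in> syms k" for s
    unfolding n0_def
    using that demands_of_users(1)[OF \<omega>[unfolded w]] by (intro src_row_demanded symsD)
  \<comment> \<open>Under any other request, message \<open>s\<close> would take its packet of file
    \<open>n0\<close> from a cached row of \<open>\<omega>'\<close>. Its label would then occur in
    the cache of \<open>\<omega>\<close> too, where it belongs to the uncached row
    \<open>tail_row s k\<close>.\<close>
  have "d' k = n0"
  proof (rule ccontr)
    assume "d' k \<noteq> n0"
    obtain s where s: "s \<in> syms k" using syms_nonempty[OF k] by blast
    let ?j = "src_row d' s n0"
    have "?j \<in> cached_rows k"
      using \<open>d' k \<noteq> n0\<close> by (intro src_row_cached[OF s]) simp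
    then have "(n0, \<phi>' n0 ?j, packet B F (W' n0) ?j) \<in> cached_packets K F S N B P k \<omega>"
      unfolding cache w' cached_packets_eq[OF k] using n0 by blast
    then obtain j where j: "j \<in> cached_rows k" "\<phi>' n0 ?j = \<phi> n0 j"
      unfolding w cached_packets_eq[OF k] by blast
    then have "\<phi> n0 (tail_row s k) = \<phi> n0 j"
      using header[OF s n0] tail[OF s] by simp
    then have "tail_row s k = j" using inj n0 by blast
    then show False using j(1) tail_notin_cached[OF s] by simp
  qed
  then have tail': "src_row d' s n0 = tail_row s k" if "s \<in> syms k" for s
    using that demands_of_users(1)[OF \<omega>'[unfolded w']] src_row_demanded symsD by metis
  have perm0: "\<phi> n0 = \<phi>' n0"
    using perm \<open>d' k = n0\<close> by (simp add: private_permutation_def w w' n0_def)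
  have "W n0 = W' n0"
  proof (rule file_eqI[OF O(1)[OF n0] O'(1)[OF n0] F_dvd_B])
    fix j assume j: "j < F"
    show "packet B F (W n0) j = packet B F (W' n0) j"
    proof (cases "j \<in> cached_rows k")
      case True
      then show ?thesis using cached[OF n0 True j] perm0 by simp
    next
      case False
      then obtain s where s: "s \<in> syms k" and j_eq: "j = tail_row s k"
        using uncached_row[OF j k] by blast
      note sS = symsD(1)[OF s]
      have "T s = T' s"
        using fun_cong[OF keys, of s] s by (simp add: cached_keys_def w w')
      moreover have "broadcast K F N B P s \<omega> = broadcast K F N B P s \<omega>'"
        using fun_cong[OF bc, of s] s by (simp add: broadcasts_for_def)
      ultimately have "xor (T s) (payload K F N B P s \<omega>) = xor (T s) (payload K F N B P s \<omega>')"
        by (simp add: broadcast_def w w')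
      then have "payload K F N B P s \<omega> = payload K F N B P s \<omega>'"
        by (rule xor_left_cancel) (simp_all add: O(5)[OF sS] length_payload)
      then have "xor_sum (B div F) {..<N} (\<lambda>n. packet B F (W n) (src_row d s n)) =
          xor_sum (B div F) {..<N} (\<lambda>n. packet B F (W' n) (src_row d' s n))"
        using payload_eq[OF \<omega>[unfolded w] sS] payload_eq[OF \<omega>'[unfolded w'] sS] by (simp add: w w')
      \<comment> \<open>The packets of all other files are cached, with equal labels by
        \<open>header\<close>, so they agree and cancel from both sums.\<close>
      then have "packet B F (W n0) (src_row d s n0) = packet B F (W' n0) (src_row d' s n0)"
      proof (rule xor_sum_cancel)
        fix n assume n: "n \<in> {..<N}" "n \<noteq> n0"
        then have "src_row d s n \<in> cached_rows k"
          by (intro src_row_cached[OF s]) (simp add: n0_def)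
        then show "packet B F (W n) (src_row d s n) = packet B F (W' n) (src_row d' s n)"
          using n header[OF s, of n] src_row_less[OF sS] by (intro cached) auto
      qed (use n0 src_row_less[OF sS] in \<open>simp_all add: length_packet O(1) O'(1) F_dvd_B\<close>)
      then show ?thesis by (simp add: tail[OF s] tail'[OF s] j_eq)
    qed
  qed
  then show ?thesis
    using \<open>d' k = n0\<close> by (simp add: requested_file_def w w' n0_def)
qed

lemma decodable: "decodable K F S N B P"
  unfolding decodable_def outcome_measure_def
proof (intro allI impI)
  fix k assume k: "k < K"
  show "cond_entropy (uniform_count_measure \<Omega>) (requested_file k)
      (\<lambda>\<omega>. (cached_packets K F S N B P k \<omega>, cached_keys K F S P k \<omega>,
             broadcasts_for K F S N B P k \<omega>, private_permutation k \<omega>)) = 0"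
  proof (rule cond_entropy_eq_0[OF finite_outcomes outcomes_nonempty[OF K_le_N]])
    fix \<omega> \<omega>' assume "\<omega> \<in> \<Omega>" "\<omega>' \<in> \<Omega>"
      and "(cached_packets K F S N B P k \<omega>, cached_keys K F S P k \<omega>,
          broadcasts_for K F S N B P k \<omega>, private_permutation k \<omega>) =
        (cached_packets K F S N B P k \<omega>', cached_keys K F S P k \<omega>',
          broadcasts_for K F S N B P k \<omega>', private_permutation k \<omega>')"
    then show "requested_file k \<omega> = requested_file k \<omega>'"
      using decode[OF k, of \<omega> \<omega>'] unfolding prod.inject by blast
  qed
qed

end

section \<open>Demand privacy, memory and rate\<close>

context caching_scheme begin

text \<open>Moving the content of position \<open>\<sigma> n j\<close> of file \<open>n\<close> to position \<open>j\<close>, together with its label,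
  changes no labelled packet; choosing \<open>\<sigma>\<close> suitably turns the messages for the demand \<open>d\<close> into
  those for \<open>d'\<close>.\<close>

definition relabel :: "(nat \<Rightarrow> nat \<Rightarrow> nat) \<Rightarrow> (nat \<Rightarrow> nat) \<Rightarrow> outcome \<Rightarrow> outcome" where
  "relabel \<sigma> d' = (\<lambda>(W, d, \<phi>, T).
     (\<lambda>n\<in>{..<N}. permute_packets B F (\<sigma> n) (W n), d', \<lambda>n\<in>{..<N}. \<phi> n \<circ> \<sigma> n, T))"

lemma relabel_in_outcomes:
  assumes \<omega>: "(W, d, \<phi>, T) \<in> \<Omega>" and \<omega>': "(W', d', \<phi>', T') \<in> \<Omega>"
    and \<sigma>: "\<And>n. n < N \<Longrightarrow> \<sigma> n permutes {..<F}"
  shows "relabel \<sigma> d' (W, d, \<phi>, T) \<in> \<Omega>"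
proof -
  have "(\<lambda>n\<in>{..<N}. permute_packets B F (\<sigma> n) (W n)) \<in> {..<N} \<rightarrow>\<^sub>E bitstrings B"
    by (rule restrict_PiE_iff[THEN iffD2]) (simp add: bitstrings_def)
  moreover have "(\<lambda>n\<in>{..<N}. \<phi> n \<circ> \<sigma> n) \<in> {..<N} \<rightarrow>\<^sub>E {\<pi>. \<pi> permutes {..<F}}"
    using \<sigma> outcomesD(4)[OF \<omega>] by (intro restrict_PiE_iff[THEN iffD2]) (simp add: permutes_compose)
  moreover have "d' \<in> {d \<in> {..<K} \<rightarrow>\<^sub>E {..<N}. inj_on d {..<K}}"
    using \<omega>' unfolding outcomes_def mem_Sigma_iff by (elim conjE)
  moreover have "T \<in> {..<S} \<rightarrow>\<^sub>E bitstrings (B div F)"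
    using \<omega> unfolding outcomes_def mem_Sigma_iff by (elim conjE)
  ultimately show ?thesis
    unfolding outcomes_def relabel_def prod.case mem_Sigma_iff by (intro conjI)
qed

text \<open>\<open>relabel\<close> overwrites the demand vector, hence the restriction to outcomes
  with one fixed \<open>d\<close>; there the inverses of the \<open>\<sigma> n\<close> recover
  labels and files.\<close>

lemma inj_on_relabel:
  assumes \<sigma>: "\<And>n. n < N \<Longrightarrow> \<sigma> n permutes {..<F}"
  shows "inj_on (relabel \<sigma> d') {\<omega>\<in>\<Omega>. fst (snd \<omega>) = d}"
proof (rule inj_onI)
  fix \<omega> \<omega>' assume a: "\<omega> \<in> {\<omega>\<in>\<Omega>. fst (snd \<omega>) = d}" "\<omega>' \<in> {\<omega>\<in>\<Omega>. fst (snd \<omega>) = d}"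
    and eq: "relabel \<sigma> d' \<omega> = relabel \<sigma> d' \<omega>'"
  obtain W \<phi> T where w: "\<omega> = (W, d, \<phi>, T)" using a(1) by (cases \<omega>) simp
  obtain W' \<phi>' T' where w': "\<omega>' = (W', d, \<phi>', T')" using a(2) by (cases \<omega>') simp
  have in\<Omega>: "(W, d, \<phi>, T) \<in> \<Omega>" "(W', d, \<phi>', T') \<in> \<Omega>" using a by (simp_all add: w w')
  have eqs: "(\<lambda>n\<in>{..<N}. permute_packets B F (\<sigma> n) (W n)) = (\<lambda>n\<in>{..<N}. permute_packets B F (\<sigma> n) (W' n))"
    "(\<lambda>n\<in>{..<N}. \<phi> n \<circ> \<sigma> n) = (\<lambda>n\<in>{..<N}. \<phi>' n \<circ> \<sigma> n)" "T = T'"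
    using eq unfolding w w' relabel_def prod.case prod.inject by simp_all
  have "\<phi> n = \<phi>' n" if n: "n < N" for n
  proof -
    have "\<phi> n \<circ> \<sigma> n = \<phi>' n \<circ> \<sigma> n" using fun_cong[OF eqs(2), of n] n by simp
    then have "\<phi> n \<circ> (\<sigma> n \<circ> inv (\<sigma> n)) = \<phi>' n \<circ> (\<sigma> n \<circ> inv (\<sigma> n))"
      unfolding comp_assoc[symmetric] by simp
    then show ?thesis by (simp add: permutes_inv_o(1)[OF \<sigma>[OF n]])
  qed
  moreover have "\<phi> \<in> extensional {..<N}" "\<phi>' \<in> extensional {..<N}"
    using in\<Omega> by (auto simp: outcomes_def PiE_iff)
  ultimately have \<phi>: "\<phi> = \<phi>'" by (intro extensionalityI[of \<phi> "{..<N}" \<phi>']) auto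
  have "W n = W' n" if n: "n < N" for n
  proof (rule file_eqI[OF outcomesD(1)[OF in\<Omega>(1) n] outcomesD(1)[OF in\<Omega>(2) n] F_dvd_B])
    fix j assume j: "j < F"
    let ?i = "inv (\<sigma> n) j"
    have i: "?i < F" "\<sigma> n ?i = j"
      using permutes_in_image[OF permutes_inv[OF \<sigma>[OF n]], of j] j permutes_inverses(1)[OF \<sigma>[OF n]] by simp_all
    have "permute_packets B F (\<sigma> n) (W n) = permute_packets B F (\<sigma> n) (W' n)"
      using fun_cong[OF eqs(1), of n] n by simp
    then show "packet B F (W n) j = packet B F (W' n) j"
      using packet_permute_packets[OF outcomesD(1)[OF in\<Omega>(1) n] F_dvd_B i(1), of "\<sigma> n"]
        packet_permute_packets[OF outcomesD(1)[OF in\<Omega>(2) n] F_dvd_B i(1), of "\<sigma> n"] i j by simp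
  qed
  moreover have "W \<in> extensional {..<N}" "W' \<in> extensional {..<N}"
    using in\<Omega> by (auto simp: outcomes_def PiE_iff)
  ultimately have "W = W'" by (intro extensionalityI[of W "{..<N}" W']) auto
  then show "\<omega> = \<omega>'" using \<phi> eqs(3) by (simp add: w w')
qed

lemma packet_relabel:
  assumes "(W, d, \<phi>, T) \<in> \<Omega>" "\<pi> permutes {..<F}" "n < N" "j < F"
  shows "packet B F (permute_packets B F \<pi> (W n)) j = packet B F (W n) (\<pi> j)"
  using packet_permute_packets[OF outcomesD(1)[OF assms(1,3)] F_dvd_B assms(4)]
    permutes_in_image[OF assms(2), of j] assms(4) by simp

text \<open>The cache does not record positions: since \<open>\<sigma> n\<close> permutes the cached
  rows, the same set of triples is only enumerated in another order.\<close>

lemma cached_packets_relabel: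
  assumes k: "k < K" and \<omega>: "(W, d, \<phi>, T) \<in> \<Omega>"
    and \<sigma>: "\<And>n. n < N \<Longrightarrow> \<sigma> n permutes {..<F}" "\<And>n. n < N \<Longrightarrow> \<sigma> n permutes cached_rows k"
  shows "cached_packets K F S N B P k (relabel \<sigma> d' (W, d, \<phi>, T)) =
    cached_packets K F S N B P k (W, d, \<phi>, T)"
proof -
  have 1: "{((\<lambda>n\<in>{..<N}. \<phi> n \<circ> \<sigma> n) n j, packet B F ((\<lambda>n\<in>{..<N}. permute_packets B F (\<sigma> n) (W n)) n) j) |
        j. j \<in> cached_rows k} = {(\<phi> n j, packet B F (W n) j) | j. j \<in> cached_rows k}"
    (is "{?f j | j. _} = {?g j | j. _}") if n: "n < N" for n
  proof -
    have "?f j = ?g (\<sigma> n j)" if "j \<in> cached_rows k" for j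
      using n packet_relabel[OF \<omega> \<sigma>(1)[OF n] n cached_rows_less[OF that]] by simp
    then have "?f ` cached_rows k = ?g ` \<sigma> n ` cached_rows k"
      by (simp add: image_image)
    then show ?thesis
      unfolding permutes_image[OF \<sigma>(2)[OF n]] by (simp only: Setcompr_eq_image)
  qed
  have "{(n, f n j, g n j) | n j. n < N \<and> j \<in> C} = (\<Union>n<N. Pair n ` {(f n j, g n j) | j. j \<in> C})"
    for f :: "nat \<Rightarrow> nat \<Rightarrow> nat" and g :: "nat \<Rightarrow> nat \<Rightarrow> bit list" and C :: "nat set"
    by blast
  note split = this[of _ _ "cached_rows k"]
  show ?thesis
    unfolding relabel_def prod.case cached_packets_eq[OF k] split
    by (rule SUP_cong) (simp_all only: 1 lessThan_iff)
qed

text \<open>After relabelling, row \<open>src_row d' s n\<close> carries the label and content that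
  row \<open>\<sigma> n (src_row d' s n)\<close> had before, and this is the row
  \<open>src_row d s n\<close> used under the demand \<open>d\<close>.\<close>

lemma messages_for_relabel:
  assumes \<omega>: "(W, d, \<phi>, T) \<in> \<Omega>" and \<omega>': "relabel \<sigma> d' (W, d, \<phi>, T) \<in> \<Omega>"
    and \<sigma>: "\<And>n. n < N \<Longrightarrow> \<sigma> n permutes {..<F}"
    and src: "\<And>n s. n < N \<Longrightarrow> s \<in> syms k \<Longrightarrow> \<sigma> n (src_row d' s n) = src_row d s n"
  shows "messages_for K F S N B P k (relabel \<sigma> d' (W, d, \<phi>, T)) =
    messages_for K F S N B P k (W, d, \<phi>, T)"
  unfolding messages_for_def
proof (rule restrict_ext)
  fix s assume s: "s \<in> syms k"
  note sS = symsD(1)[OF s]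
  note \<omega>'' = \<omega>'[unfolded relabel_def prod.case]
  have "header K F N P s (relabel \<sigma> d' (W, d, \<phi>, T)) = header K F N P s (W, d, \<phi>, T)"
    unfolding header_eq[OF \<omega> sS] unfolding relabel_def prod.case header_eq[OF \<omega>'' sS]
    using src[OF _ s] by simp
  moreover have "payload K F N B P s (relabel \<sigma> d' (W, d, \<phi>, T)) = payload K F N B P s (W, d, \<phi>, T)"
    unfolding payload_eq[OF \<omega> sS] unfolding relabel_def prod.case payload_eq[OF \<omega>'' sS]
    by (rule xor_sum_cong) (simp add: packet_relabel[OF \<omega> \<sigma> _ src_row_less[OF sS]] src[OF _ s])
  ultimately show "(header K F N P s (relabel \<sigma> d' (W, d, \<phi>, T)), payload K F N B P s (relabel \<sigma> d' (W, d, \<phi>, T))) =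
      (header K F N P s (W, d, \<phi>, T), payload K F N B P s (W, d, \<phi>, T))"
    by simp
qed

text \<open>For \<open>n \<noteq> d k\<close> both families of source rows lie in
  \<open>cached_rows k\<close> and are injective in the symbol, so their matching extends to a
  permutation. For \<open>n = d k\<close> both equal \<open>tail_row s k\<close>, and the identity
  keeps the permutation known to user \<open>k\<close> unchanged.\<close>

lemma aligning_permutations:
  assumes k: "k < K" and d: "inj_on d {..<K}" and d': "inj_on d' {..<K}" and dk: "d' k = d k"
  obtains \<sigma> where "\<And>n. \<sigma> n permutes cached_rows k" "\<sigma> (d k) = id"
    "\<And>n s. s \<in> syms k \<Longrightarrow> \<sigma> n (src_row d' s n) = src_row d s n"
proof -
  have "\<exists>\<sigma>. \<sigma> permutes cached_rows k \<and> (n = d k \<longrightarrow> \<sigma> = id) \<and>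
      (\<forall>s\<in>syms k. \<sigma> (src_row d' s n) = src_row d s n)" for n
  proof (cases "n = d k")
    case True
    have "src_row d s n = tail_row s k" "src_row d' s n = tail_row s k" if "s \<in> syms k" for s
      using src_row_demanded[of d s k] src_row_demanded[of d' s k] symsD(2)[OF that] d d' dk users_less
        inj_on_subset[OF d, of "users s"] inj_on_subset[OF d', of "users s"] True by auto
    then show ?thesis using True permutes_id by (intro exI[of _ id]) simp
  next
    case False
    have "\<exists>\<sigma>. \<sigma> permutes cached_rows k \<and> (\<forall>s\<in>syms k. \<sigma> (src_row d' s n) = src_row d s n)"
      using False dk src_row_cached[of _ k n] 
      by (intro permutes_extending finite_cached_rows inj_on_src_row[OF d] inj_on_src_row[OF d'])
        auto
    then show ?thesis using False by blast
  qed
  then obtain \<sigma> where "\<forall>n. \<sigma> n permutes cached_rows k \<and> (n = d k \<longrightarrow> \<sigma> n = id) \<and>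
      (\<forall>s\<in>syms k. \<sigma> n (src_row d' s n) = src_row d s n)" by metis
  then show thesis by (intro that[of \<sigma>]) simp_all
qed

lemma demand_private: "demand_private K F S N B P"
  unfolding demand_private_def outcome_measure_def
proof (intro allI impI)
  fix k assume k: "k < K"
  let ?X = "other_demands K k" and ?Y = "messages_for K F S N B P k"
  let ?Z = "\<lambda>\<omega>. (private_permutation k \<omega>, cached_packets K F S N B P k \<omega>,
               own_demand k \<omega>, user_groups K F S P k \<omega>)"
  show "cond_mutual_info (uniform_count_measure \<Omega>) ?X ?Y ?Z = 0"
  proof (rule cond_mutual_info_eq_0[OF finite_outcomes outcomes_nonempty[OF K_le_N]])
    fix \<omega>1 \<omega>2 y
    assume \<omega>12: "\<omega>1 \<in> \<Omega>" "\<omega>2 \<in> \<Omega>" and Z12: "?Z \<omega>1 = ?Z \<omega>2"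
    obtain W1 d \<phi>1 T1 where w1: "\<omega>1 = (W1, d, \<phi>1, T1)" by (cases \<omega>1)
    obtain W2 d' \<phi>2 T2 where w2: "\<omega>2 = (W2, d', \<phi>2, T2)" by (cases \<omega>2)
    note in1 = \<omega>12(1)[unfolded w1] and in2 = \<omega>12(2)[unfolded w2]
    have dk: "d' k = d k" using Z12 by (simp add: own_demand_def w1 w2)
    obtain \<sigma> where \<sigma>: "\<And>n. \<sigma> n permutes cached_rows k" "\<sigma> (d k) = id"
      "\<And>n s. s \<in> syms k \<Longrightarrow> \<sigma> n (src_row d' s n) = src_row d s n"
      using aligning_permutations[OF k outcomesD(2)[OF in1] outcomesD(2)[OF in2] dk] by blast
    have \<sigma>F: "\<sigma> n permutes {..<F}" for n
      by (rule permutes_subset[OF \<sigma>(1)]) (auto dest: cached_rows_less)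
    let ?A = "\<lambda>\<omega>. {\<eta>\<in>\<Omega>. ?X \<eta> = ?X \<omega> \<and> ?Y \<eta> = y \<and> ?Z \<eta> = ?Z \<omega>1}"
    \<comment> \<open>Fixing \<open>?X\<close> and \<open>?Z\<close> fixes the whole demand vector:
      \<open>?X\<close> gives the other demands and \<open>?Z\<close> the own one. This places the
      fibre in the domain where \<open>relabel\<close> is injective.\<close>
    have demand: "fst (snd \<eta>) = d" if "\<eta> \<in> ?A \<omega>1" for \<eta>
    proof -
      obtain W e \<phi> T where w: "\<eta> = (W, e, \<phi>, T)" by (cases \<eta>)
      have others: "restrict e ({..<K} - {k}) = restrict d ({..<K} - {k})" and "e k = d k"
        using that by (simp_all add: other_demands_def own_demand_def w w1)
      then have "e l = d l" if "l < K" for l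
        proof (cases "l = k")
        case False
        have "restrict e ({..<K} - {k}) l = restrict d ({..<K} - {k}) l" by (simp only: others)
        then show ?thesis using that False by (simp only: restrict_apply) simp
      qed (use \<open>e k = d k\<close> in simp)
      moreover have "e \<in> extensional {..<K}" "d \<in> extensional {..<K}"
        using that in1 by (auto simp: outcomes_def PiE_iff w)
      ultimately show ?thesis unfolding w by (auto intro: extensionalityI[of e "{..<K}" d])
    qed
    have "relabel \<sigma> d' \<eta> \<in> ?A \<omega>2" if \<eta>: "\<eta> \<in> ?A \<omega>1" for \<eta>
    proof -
      obtain W \<phi> T where w: "\<eta> = (W, d, \<phi>, T)" using demand[OF \<eta>] by (cases \<eta>) simp
      have \<eta>\<Omega>: "(W, d, \<phi>, T) \<in> \<Omega>" using \<eta> w by simp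
      have \<eta>'\<Omega>: "relabel \<sigma> d' (W, d, \<phi>, T) \<in> \<Omega>"
        by (rule relabel_in_outcomes[OF \<eta>\<Omega> in2 \<sigma>F])
      have "cached_packets K F S N B P k (relabel \<sigma> d' \<eta>) = cached_packets K F S N B P k \<eta>"
        unfolding w by (rule cached_packets_relabel[OF k \<eta>\<Omega> \<sigma>F \<sigma>(1)])
      moreover have "?Y (relabel \<sigma> d' \<eta>) = ?Y \<eta>"
        unfolding w by (rule messages_for_relabel[OF \<eta>\<Omega> \<eta>'\<Omega> \<sigma>F \<sigma>(3)])
      moreover have "private_permutation k (relabel \<sigma> d' \<eta>) = private_permutation k \<eta>"
        using outcomesD(3)[OF in1 k] by (simp add: w relabel_def private_permutation_def dk \<sigma>(2))
      moreover have "own_demand k (relabel \<sigma> d' \<eta>) = own_demand k \<eta>"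
        by (simp add: w relabel_def own_demand_def dk)
      moreover have "user_groups K F S P k (relabel \<sigma> d' \<eta>) = user_groups K F S P k \<eta>"
        by (simp add: user_groups_def)
      moreover have "?X (relabel \<sigma> d' \<eta>) = ?X \<omega>2"
        by (simp add: w w2 relabel_def other_demands_def)
      ultimately show ?thesis using \<eta> \<eta>'\<Omega> w by simp
    qed
    then have "relabel \<sigma> d' ` ?A \<omega>1 \<subseteq> ?A \<omega>2" by blast
    moreover have "inj_on (relabel \<sigma> d') (?A \<omega>1)"
    proof (rule inj_on_subset)
      show "inj_on (relabel \<sigma> d') {\<omega>\<in>\<Omega>. fst (snd \<omega>) = d}" using \<sigma>F by (rule inj_on_relabel)
      show "?A \<omega>1 \<subseteq> {\<omega>\<in>\<Omega>. fst (snd \<omega>) = d}" using demand by blast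
    qed
    moreover have "finite (?A \<omega>2)" using finite_outcomes by (rule finite_subset[rotated]) blast
    ultimately show "card (?A \<omega>1) \<le> card (?A \<omega>2)" by (intro card_inj_on_le)
  qed
qed

text \<open>The cache is a set, so coinciding triples would be counted once. The labels of a file
  are distinct, hence packets with equal content still yield distinct triples.\<close>

lemma has_memory:
  assumes size: "\<And>k. k < K \<Longrightarrow> card (cached_rows k) = c"
  shows "has_memory K F S N B P (real N * real c / real F)"
  unfolding has_memory_def
proof (intro ballI allI impI)
  fix \<omega> k assume \<omega>: "\<omega> \<in> \<Omega>" and k: "k < K"
  obtain W d \<phi> T where w: "\<omega> = (W, d, \<phi>, T)" by (cases \<omega>)
  note O = outcomesD[OF \<omega>[unfolded w]]
  let ?h = "\<lambda>(n, j). (n, \<phi> n j, packet B F (W n) j)"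
  have inj: "inj_on ?h ({..<N} \<times> cached_rows k)"
  proof (rule inj_onI, clarsimp)
    fix n i j assume "n < N" "\<phi> n i = \<phi> n j"
    then show "i = j" using permutes_inj[OF O(4)] by (simp add: inj_eq)
  qed
  have img: "cached_packets K F S N B P k \<omega> = ?h ` ({..<N} \<times> cached_rows k)"
    unfolding w cached_packets_eq[OF k] by auto
  have "(\<Sum>(n, l, v)\<in>cached_packets K F S N B P k \<omega>. length v) =
      (\<Sum>(n, j)\<in>{..<N} \<times> cached_rows k. length (packet B F (W n) j))"
    unfolding img sum.reindex[OF inj] by (simp add: case_prod_beta comp_def)
  also have "\<dots> = (\<Sum>(n, j)\<in>{..<N} \<times> cached_rows k. B div F)"
    by (rule sum.cong) (auto simp: length_packet O(1) F_dvd_B cached_rows_less)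
  also have "\<dots> = N * c * (B div F)"
    using size[OF k] by (simp add: case_prod_beta card_cartesian_product)
  finally have "(\<Sum>(n, l, v)\<in>cached_packets K F S N B P k \<omega>. length v) = N * c * (B div F)" .
  then show "real (\<Sum>(n, l, v)\<in>cached_packets K F S N B P k \<omega>. length v) =
      real N * real c / real F * real B"
    by (simp only: of_nat_mult real_of_nat_div[OF F_dvd_B]) simp
qed

lemma has_rate: "has_rate K F S N B P (real S / real F)"
  unfolding has_rate_def
proof
  fix \<omega> assume \<omega>: "\<omega> \<in> \<Omega>"
  obtain W d \<phi> T where w: "\<omega> = (W, d, \<phi>, T)" by (cases \<omega>)
  have "length (broadcast K F N B P s \<omega>) = B div F" if "s < S" for s
    using outcomesD(5)[OF \<omega>[unfolded w] that] by (simp add: broadcast_def w length_payload)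
  then have "(\<Sum>s<S. length (broadcast K F N B P s \<omega>)) = S * (B div F)" by simp
  then show "real (\<Sum>s<S. length (broadcast K F N B P s \<omega>)) / real B = real S / real F"
    using F_dvd_B B_pos by (simp add: real_of_nat_div)
qed

lemma has_subpacketization: "has_subpacketization K F S N B F"
  by (auto simp: has_subpacketization_def split_file_def)

end

section \<open>The array\<close>

text \<open>The converse of \<open>spda_symbol\<close>: conditions (C2) and (C3) are obtained from a
  group \<open>A\<close>, a constant row \<open>j0\<close> and diagonal rows \<open>q k\<close>. The
  number of occurrences is \<open>2 * card A\<close>.\<close>

lemma symbol_condI:
  assumes A: "A \<subseteq> {..<K}" "2 \<le> card A" and j0: "j0 < F" and q: "inj_on q A"
    "\<And>k. k \<in> A \<Longrightarrow> q k < F" "\<And>k. k \<in> A \<Longrightarrow> q k \<noteq> j0"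
    and occ: "\<And>j k. j < F \<Longrightarrow> k < K \<Longrightarrow> P j k = Sym s \<longleftrightarrow> k \<in> A \<and> (j = j0 \<or> j = q k)"
    and star: "\<And>k l. k \<in> A \<Longrightarrow> l \<in> A \<Longrightarrow> k \<noteq> l \<Longrightarrow> P (q k) l = Star"
  shows "4 \<le> card {(j, k). j < F \<and> k < K \<and> P j k = Sym s}"
    and "\<exists>(g::nat) r c. bij_betw r {..<g + 1} (rows_with K F P s) \<and>
        bij_betw c {..<g} (cols_with K F P s) \<and> (\<forall>l<g. P (r 0) (c l) = Sym s) \<and>
        (\<forall>i<g. \<forall>l<g. P (r (i + 1)) (c l) = (if i = l then Sym s else Star))"
proof -
  have finA: "finite A" using A(1) by (rule finite_subset) simp
  have AK: "k < K" if "k \<in> A" for k using A(1) that by auto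
  have "{(j, k). j < F \<and> k < K \<and> P j k = Sym s} = Pair j0 ` A \<union> (\<lambda>k. (q k, k)) ` A"
    using occ j0 q(2) AK by auto
  moreover have "card (Pair j0 ` A \<union> (\<lambda>k. (q k, k)) ` A) = card (Pair j0 ` A) + card ((\<lambda>k. (q k, k)) ` A)"
    using finA q(3) by (intro card_Un_disjoint) auto
  ultimately show "4 \<le> card {(j, k). j < F \<and> k < K \<and> P j k = Sym s}"
    using A(2) by (simp add: card_image inj_on_def)
  obtain c where c: "bij_betw c {..<card A} A"
    using ex_bij_betw_nat_finite[OF finA] by (auto simp: atLeast0LessThan)
  have c_img: "c ` {..<card A} = A" and c_inj: "inj_on c {..<card A}"
    using c by (simp_all add: bij_betw_def)
  \<comment> \<open>The constant row comes at index 0; the others follow the enumeration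
    \<open>c\<close> of the columns, which puts \<open>s\<close> on the diagonal.\<close>
  define r where "r i = (case i of 0 \<Rightarrow> j0 | Suc i' \<Rightarrow> q (c i'))" for i
  have cA: "c i \<in> A" if "i < card A" for i using c_img that by blast
  have "A \<noteq> {}" using A(2) by auto
  then have cols: "cols_with K F P s = A"
    using occ j0 AK by (auto simp: cols_with_def)
  have rows: "rows_with K F P s = insert j0 (q ` A)"
  proof (rule equalityI)
    show "rows_with K F P s \<subseteq> insert j0 (q ` A)"
      using occ by (auto simp: rows_with_def)
    have "k < K \<and> P j0 k = Sym s \<and> P (q k) k = Sym s" if "k \<in> A" for k
      using occ[OF j0 AK[OF that]] occ[OF q(2)[OF that] AK[OF that]] AK[OF that] that by simp
    then show "insert j0 (q ` A) \<subseteq> rows_with K F P s"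
      using j0 q(2) \<open>A \<noteq> {}\<close> unfolding rows_with_def by blast
  qed
  have "r ` {..<card A + 1} = insert j0 (q ` c ` {..<card A})"
    by (simp add: lessThan_Suc_eq_insert_0 r_def image_image)
  moreover have "inj_on r {..<card A + 1}"
  proof -
    have "inj_on (\<lambda>i. q (c i)) {..<card A}"
      using comp_inj_on[OF c_inj, of q] q(1) c_img by (simp add: comp_def)
    moreover have "q (c i) \<noteq> j0" if "i < card A" for i using q(3) cA that by blast
    ultimately show ?thesis
      by (auto simp: inj_on_def r_def split: nat.splits)
  qed
  ultimately have "bij_betw r {..<card A + 1} (rows_with K F P s)"
    by (simp add: bij_betw_def rows c_img)
  moreover have "bij_betw c {..<card A} (cols_with K F P s)"
    using c by (simp add: cols)
  moreover have "P (r 0) (c l) = Sym s" if "l < card A" for l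
    using occ[OF j0 AK[OF cA[OF that]]] cA[OF that] by (simp add: r_def)
  moreover have "P (r (i + 1)) (c l) = (if i = l then Sym s else Star)"
    if "i < card A" "l < card A" for i l
  proof (cases "i = l")
    case True
    then show ?thesis
      using occ[OF q(2)[OF cA] AK[OF cA], OF that] cA[OF that(1)] by (simp add: r_def)
  next
    case False
    then have "c i \<noteq> c l" using c_inj that by (auto simp: inj_on_def)
    then show ?thesis using star cA that False by (simp add: r_def)
  qed
  ultimately show "\<exists>(g::nat) r c. bij_betw r {..<g + 1} (rows_with K F P s) \<and>
        bij_betw c {..<g} (cols_with K F P s) \<and> (\<forall>l<g. P (r 0) (c l) = Sym s) \<and>
        (\<forall>i<g. \<forall>l<g. P (r (i + 1)) (c l) = (if i = l then Sym s else Star))"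
    by (intro exI[of _ "card A"] exI[of _ r] exI[of _ c]) blast
qed

lemma card_subsets_containing:
  assumes "finite X" "x \<in> X" "0 < n"
  shows "card {A. A \<subseteq> X \<and> card A = n \<and> x \<in> A} = (card X - 1) choose (n - 1)"
proof -
  have "{A. A \<subseteq> X \<and> card A = n \<and> x \<in> A} = insert x ` {A. A \<subseteq> X - {x} \<and> card A = n - 1}"
  proof (intro set_eqI iffI)
    fix A assume A: "A \<in> {A. A \<subseteq> X \<and> card A = n \<and> x \<in> A}"
    then have "A = insert x (A - {x})" "A - {x} \<in> {A. A \<subseteq> X - {x} \<and> card A = n - 1}"
      using assms(1) by (auto simp: finite_subset)
    then show "A \<in> insert x ` {A. A \<subseteq> X - {x} \<and> card A = n - 1}" by (rule image_eqI)
  next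
    fix A assume "A \<in> insert x ` {A. A \<subseteq> X - {x} \<and> card A = n - 1}"
    then obtain A' where A': "A = insert x A'" "A' \<subseteq> X - {x}" "card A' = n - 1" by blast
    then have "finite A'" "x \<notin> A'" using assms(1) by (auto intro: finite_subset)
    then show "A \<in> {A. A \<subseteq> X \<and> card A = n \<and> x \<in> A}" using A' assms(2,3) by auto
  qed
  moreover have "inj_on (insert x) {A. A \<subseteq> X - {x} \<and> card A = n - 1}"
    by (rule inj_onI) (simp add: insert_ident subset_Diff_insert)
  moreover have "card {A. A \<subseteq> X - {x} \<and> card A = n - 1} = (card X - 1) choose (n - 1)"
    using n_subsets[of "X - {x}" "n - 1"] assms by simp
  ultimately show ?thesis by (simp add: card_image)
qed

text \<open>Rows \<open>j < K choose t\<close> form the Maddah-Ali--Niesen array on \<open>t\<close>-subsets; row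
  \<open>(K choose t) + i\<close> carries the pairwise disjoint \<open>(t + 1)\<close>-subsets of colour \<open>i\<close>, each written
  into all of its columns.\<close>

lemma spda_from_colouring:
  fixes K t M :: nat and col :: "nat set \<Rightarrow> nat"
  assumes t: "0 < t" "t < K"
    and col: "\<And>A. A \<subseteq> {..<K} \<Longrightarrow> card A = t + 1 \<Longrightarrow> col A < M"
    and disj: "\<And>A A'. A \<subseteq> {..<K} \<Longrightarrow> A' \<subseteq> {..<K} \<Longrightarrow> card A = t + 1 \<Longrightarrow> card A' = t + 1 \<Longrightarrow>
      col A = col A' \<Longrightarrow> A \<noteq> A' \<Longrightarrow> A \<inter> A' = {}"
  shows "\<exists>P. spda K ((K choose t) + M) (((K - 1) choose (t - 1)) + M - ((K - 1) choose t)) (K choose (t + 1)) P"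
    and "(K - 1) choose t \<le> M"
proof -
  define n where "n = K choose t"
  define S where "S = K choose (t + 1)"
  let ?T = "{A. A \<subseteq> {..<K} \<and> card A = t}" and ?U = "{A. A \<subseteq> {..<K} \<and> card A = t + 1}"
  have card_TU: "card ?T = n" "card ?U = S"
    using n_subsets[of "{..<K}"] by (simp_all add: n_def S_def)
  have fin: "finite ?T" "finite ?U" by simp_all
  obtain D where D: "bij_betw D {..<n} ?T"
    using ex_bij_betw_nat_finite[OF fin(1)] card_TU by (auto simp: atLeast0LessThan)
  obtain E where E: "bij_betw E {..<S} ?U"
    using ex_bij_betw_nat_finite[OF fin(2)] card_TU by (auto simp: atLeast0LessThan)
  have D_in: "D j \<subseteq> {..<K}" "card (D j) = t" "finite (D j)" if "j < n" for j
    using bij_betwE[OF D] that by (auto intro: finite_subset)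
  have E_in: "E s \<subseteq> {..<K}" "card (E s) = t + 1" "finite (E s)" if "s < S" for s
    using bij_betwE[OF E] that by (auto intro: finite_subset)
  have E_inj: "s = s'" if "E s = E s'" "s < S" "s' < S" for s s'
    using E that by (auto simp: bij_betw_def inj_on_def)
  have D_surj: "\<exists>j<n. D j = A" if "A \<subseteq> {..<K}" "card A = t" for A
  proof -
    have "A \<in> D ` {..<n}" using that bij_betw_imp_surj_on[OF D] by simp
    then show ?thesis by auto
  qed
  have E_surj: "\<exists>s<S. E s = A" if "A \<subseteq> {..<K}" "card A = t + 1" for A
  proof -
    have "A \<in> E ` {..<S}" using that bij_betw_imp_surj_on[OF E] by simp
    then show ?thesis by auto
  qed
  \<comment> \<open>Sets of one colour are disjoint, so a cell of an added row receives at most one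
    symbol.\<close>
  have unique: "s = s'" if "s < S" "s' < S" "k \<in> E s" "k \<in> E s'" "col (E s) = col (E s')" for s s' k
    using disj[of "E s" "E s'"] E_in that E_inj by blast
  define upper where "upper j k s \<longleftrightarrow> s < S \<and> k \<notin> D j \<and> E s = insert k (D j)" for j k s
  define lower where "lower j k s \<longleftrightarrow> s < S \<and> k \<in> E s \<and> n + col (E s) = j" for j k s
  define cell where "cell j k s \<longleftrightarrow> (if j < n then upper j k s else lower j k s)" for j k s
  have cell_unique: "s = s'" if "cell j k s" "cell j k s'" for j k s s'
    using that E_inj unique by (auto simp: cell_def upper_def lower_def split: if_splits)
  define P where "P j k = (if \<exists>s. cell j k s then Sym (THE s. cell j k s) else Star)" for j k
  have P_Sym: "P j k = Sym s \<longleftrightarrow> cell j k s" for j k s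
    using cell_unique unfolding P_def by (auto intro: theI2)
  have P_Star: "P j k = Star \<longleftrightarrow> (\<nexists>s. cell j k s)" for j k
    unfolding P_def by simp
  have star_upper: "P j k = Star \<longleftrightarrow> k \<in> D j" if jk: "j < n" "k < K" for j k
  proof (cases "k \<in> D j")
    case True
    then show ?thesis using jk by (simp add: P_Star cell_def upper_def)
  next
    case False
    then obtain s where "s < S" "E s = insert k (D j)"
      using E_surj[of "insert k (D j)"] D_in[OF jk(1)] jk by auto
    then have "cell j k s" using False jk by (simp add: cell_def upper_def)
    then show ?thesis using False by (auto simp: P_Star)
  qed
  have star_lower: "P (n + i) k = Star \<longleftrightarrow> i \<notin> (\<lambda>s. col (E s)) ` {s. s < S \<and> k \<in> E s}" for i k
    by (auto simp: P_Star cell_def lower_def)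
  have count_T: "card {j. j < n \<and> k \<in> D j} = (K - 1) choose (t - 1)" if k: "k < K" for k
  proof -
    have "D ` {j. j < n \<and> k \<in> D j} = {A. A \<subseteq> {..<K} \<and> card A = t \<and> k \<in> A}"
      using D_in D_surj by (auto simp: image_iff) metis
    moreover have "inj_on D {j. j < n \<and> k \<in> D j}"
      using D by (auto simp: bij_betw_def intro: inj_on_subset)
    ultimately show ?thesis
      using card_image[of D "{j. j < n \<and> k \<in> D j}"] card_subsets_containing[of "{..<K}" k t] k t by simp
  qed
  have count_U: "card ((\<lambda>s. col (E s)) ` {s. s < S \<and> k \<in> E s}) = (K - 1) choose t" if k: "k < K" for k
  proof -
    have "E ` {s. s < S \<and> k \<in> E s} = {A. A \<subseteq> {..<K} \<and> card A = t + 1 \<and> k \<in> A}"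
      using E_in E_surj by (auto simp: image_iff) metis
    moreover have "inj_on E {s. s < S \<and> k \<in> E s}"
      using E by (auto simp: bij_betw_def intro: inj_on_subset)
    ultimately have "card {s. s < S \<and> k \<in> E s} = (K - 1) choose t"
      using card_image[of E "{s. s < S \<and> k \<in> E s}"] card_subsets_containing[of "{..<K}" k "t + 1"] k by simp
    \<comment> \<open>Sets sharing user \<open>k\<close> have different colours, so the user meets
      as many added rows as sets.\<close>
    moreover have "inj_on (\<lambda>s. col (E s)) {s. s < S \<and> k \<in> E s}"
      using unique by (intro inj_onI) blast
    ultimately show ?thesis by (simp add: card_image)
  qed
  have col_img: "(\<lambda>s. col (E s)) ` {s. s < S \<and> k \<in> E s} \<subseteq> {..<M}" for k
    using col E_in by auto
  \<comment> \<open>A user meets \<open>(K - 1) choose t\<close> colours, all below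
    \<open>M\<close>. This makes the truncated subtraction in \<open>Z\<close> exact.\<close>
  show le: "(K - 1) choose t \<le> M"
    using card_mono[OF _ col_img[of 0]] count_U[of 0] t by simp
  have count_star: "card {j. j < n + M \<and> P j k = Star} = ((K - 1) choose (t - 1)) + M - ((K - 1) choose t)"
    if k: "k < K" for k
  proof -
    let ?C = "(\<lambda>s. col (E s)) ` {s. s < S \<and> k \<in> E s}"
    have split: "{j. j < n + M \<and> P j k = Star} = {j. j < n \<and> k \<in> D j} \<union> (+) n ` ({..<M} - ?C)"
    proof (intro set_eqI iffI)
      fix j assume j: "j \<in> {j. j < n + M \<and> P j k = Star}"
      show "j \<in> {j. j < n \<and> k \<in> D j} \<union> (+) n ` ({..<M} - ?C)"
      proof (cases "j < n")
        case False
        then obtain i where i: "j = n + i" by (metis le_add_diff_inverse not_less)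
        then have "i \<in> {..<M} - ?C" using j star_lower by simp
        then show ?thesis using i by blast
      qed (use j star_upper k in auto)
    qed (use star_upper star_lower k in auto)
    have "card ((+) n ` ({..<M} - ?C)) = card ({..<M} - ?C)"
      by (rule card_image) simp
    moreover have "card ({..<M} - ?C) = M - ((K - 1) choose t)"
      using card_Diff_subset[OF finite_subset[OF col_img[of k] finite_lessThan] col_img[of k]]
      by (simp only: count_U[OF k] card_lessThan)
    moreover have "card {j. j < n + M \<and> P j k = Star} =
        card {j. j < n \<and> k \<in> D j} + card ((+) n ` ({..<M} - ?C))"
      unfolding split by (rule card_Un_disjoint) auto
    ultimately show ?thesis using count_T[OF k] le by simp
  qed
  have symbol: "4 \<le> card {(j, k). j < n + M \<and> k < K \<and> P j k = Sym s} \<and>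
     (\<exists>(g::nat) r c. bij_betw r {..<g + 1} (rows_with K (n + M) P s) \<and>
        bij_betw c {..<g} (cols_with K (n + M) P s) \<and> (\<forall>l<g. P (r 0) (c l) = Sym s) \<and>
        (\<forall>i<g. \<forall>l<g. P (r (i + 1)) (c l) = (if i = l then Sym s else Star)))" if s: "s < S" for s
  proof -
    note Es = E_in[OF s]
    \<comment> \<open>The diagonal entry of column \<open>k\<close> lies in the row of the
      \<open>t\<close>-subset \<open>E s - {k}\<close>; every other user of \<open>E s\<close>
      belongs to that subset and has a star there.\<close>
    have "\<exists>j. k \<in> E s \<longrightarrow> j < n \<and> D j = E s - {k}" for k
    proof (cases "k \<in> E s")
      case True
      have "E s - {k} \<subseteq> {..<K}" using Es(1) by blast
      moreover have "card (E s - {k}) = t" using Es True by simp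
      ultimately show ?thesis using D_surj by blast
    qed simp
    then obtain q where q: "\<And>k. k \<in> E s \<Longrightarrow> q k < n" "\<And>k. k \<in> E s \<Longrightarrow> D (q k) = E s - {k}"
      by metis
    have q_iff: "j = q k \<longleftrightarrow> D j = E s - {k}" if "j < n" "k \<in> E s" for j k
      using q[OF that(2)] D that(1) by (auto simp: bij_betw_def inj_on_def)
    have colE: "col (E s) < M" using col Es by simp
    have "inj_on q (E s)"
      by (rule inj_onI) (metis Diff_iff q(2) singletonD singletonI)
    moreover have "P j k = Sym s \<longleftrightarrow> k \<in> E s \<and> (j = n + col (E s) \<or> j = q k)"
      if jk: "j < n + M" "k < K" for j k
    proof (cases "j < n")
      case True
      have "cell j k s \<longleftrightarrow> k \<in> E s \<and> D j = E s - {k}"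
        using True s by (auto simp: cell_def upper_def)
      then show ?thesis using True q_iff by (auto simp: P_Sym)
    next
      case False
      have "j \<noteq> q k" if "k \<in> E s" using q(1)[OF that] False by auto
      then show ?thesis using False s by (auto simp: P_Sym cell_def lower_def)
    qed
    moreover have "P (q k) l = Star" if "k \<in> E s" "l \<in> E s" "k \<noteq> l" for k l
      using star_upper[of "q k" l] q[OF that(1)] that Es(1) by auto
    moreover have "q k < n + M" "q k \<noteq> n + col (E s)" if "k \<in> E s" for k
      using q(1)[OF that] by simp_all
    ultimately show ?thesis
      using Es t colE by (intro conjI symbol_condI[of "E s" _ "n + col (E s)" _ q]) auto
  qed
  have "0 < n" using t by (simp add: n_def)
  moreover have "P j k = Star \<or> (\<exists>s<S. P j k = Sym s)" for j k
    unfolding P_Star P_Sym by (auto simp: cell_def upper_def lower_def split: if_splits)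
  ultimately have "spda K (n + M) (((K - 1) choose (t - 1)) + M - ((K - 1) choose t)) S P"
    unfolding spda_def using t count_star symbol by simp
  then show "\<exists>P. spda K ((K choose t) + M) (((K - 1) choose (t - 1)) + M - ((K - 1) choose t)) (K choose (t + 1)) P"
    unfolding n_def S_def by blast
qed

theorem theorem4:
  fixes K t K' F Z S :: nat
  assumes "0 < K" and "0 < t"
    and "\<not> (t + 1) dvd K"
    and "K div 2 > t + 1"
    and "K' = (LEAST m. K < m \<and> (t + 1) dvd m)"
    and "F = (K choose t) + ((K' - 1) choose t)"
    and "Z = ((K - 1) choose (t - 1)) + ((K' - 1) choose t) - ((K - 1) choose t)"
    and "S = K choose (t + 1)"
  shows "\<exists>P. spda K F Z S P \<and>
    (\<forall>N B. K \<le> N \<longrightarrow> 0 < B \<longrightarrow> F dvd B \<longrightarrow>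
      (\<exists>M R.
        secure_coded_caching_scheme K M N B F S P \<and>
        M / real N = real (((K - 1) choose (t - 1)) + ((K' - 1) choose t))
                     / real ((K choose t) + ((K' - 1) choose t)) \<and>
        has_rate K F S N B P R \<and>
        R = real (K choose (t + 1)) / real ((K choose t) + ((K' - 1) choose t)) \<and>
        has_subpacketization K F S N B ((K choose t) + ((K' - 1) choose t))))"
proof -
  have "t < K" using assms(4) by simp
  \<comment> \<open>A multiple of \<open>t + 1\<close> above \<open>K\<close>, so the least one
    exists.\<close>
  have "K < (t + 1) * (K + 1)" by simp
  then have "K < (t + 1) * (K + 1) \<and> (t + 1) dvd (t + 1) * (K + 1)" by (intro conjI dvd_triv_left)
  then have "K < K' \<and> (t + 1) dvd K'"
    unfolding assms(5) by (rule LeastI)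
  then obtain m where m: "K' = (t + 1) * m" and "K < K'" by (auto elim: dvdE)
  obtain col where
    col: "\<And>A. A \<subseteq> {..<K'} \<Longrightarrow> card A = t + 1 \<Longrightarrow> col A < (K' - 1) choose t"
    and disj: "\<And>A A'. A \<subseteq> {..<K'} \<Longrightarrow> A' \<subseteq> {..<K'} \<Longrightarrow> card A = t + 1 \<Longrightarrow> card A' = t + 1 \<Longrightarrow>
      col A = col A' \<Longrightarrow> A \<noteq> A' \<Longrightarrow> A \<inter> A' = {}"
    using baranyai[of "t + 1" m] unfolding m[symmetric] add_diff_cancel_right' by (metis zero_less_Suc Suc_eq_plus1)
  \<comment> \<open>The colouring is restricted to sets of real users: those meeting the
    \<open>K' - K\<close> dummy points are dropped, and disjointness and the number of available
    colours stay the same.\<close>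
  have sub: "A \<subseteq> {..<K'}" if "A \<subseteq> {..<K}" for A
    using that \<open>K < K'\<close> by auto
  have col_K: "col A < (K' - 1) choose t" if "A \<subseteq> {..<K}" "card A = t + 1" for A
    by (rule col[OF sub[OF that(1)] that(2)])
  have disj_K: "A \<inter> A' = {}" if "A \<subseteq> {..<K}" "A' \<subseteq> {..<K}" "card A = t + 1" "card A' = t + 1"
    "col A = col A'" "A \<noteq> A'" for A A'
    by (rule disj[OF sub[OF that(1)] sub[OF that(2)] that(3-6)])
  note colouring = spda_from_colouring[where col = col, OF \<open>0 < t\<close> \<open>t < K\<close> col_K disj_K]
  have "\<exists>P. spda K F Z S P"
    unfolding assms(6-8) by (rule colouring(1))
  then obtain P where P: "spda K F Z S P" by (elim exE)
  have le: "(K - 1) choose t \<le> (K' - 1) choose t"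
    by (rule colouring(2))
  have "0 < S" using \<open>t < K\<close> by (simp add: assms(8))
  interpret secure_array K F Z S P
    using P \<open>0 < S\<close> by unfold_locales
  let ?c = "((K - 1) choose (t - 1)) + ((K' - 1) choose t)"
  have pascal: "K choose t = ((K - 1) choose (t - 1)) + ((K - 1) choose t)"
    by (rule choose_reduce_nat[OF assms(1,2)])
  \<comment> \<open>Solving \<open>F = Z + 2 * card (syms k)\<close> with Pascal's rule gives
    \<open>card (syms k) = (K - 1) choose t\<close>, which cancels the subtracted term of
    \<open>Z\<close>.\<close>
  have size: "card (cached_rows k) = ?c" if "k < K" for k
    using card_cached_rows[OF that] pascal le assms(6,7) by linarith
  have "\<exists>M R. secure_coded_caching_scheme K M N B F S P \<and> M / real N = real ?c / real F \<and>
      has_rate K F S N B P R \<and> R = real S / real F \<and> has_subpacketization K F S N B F"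
    if NB: "K \<le> N" "0 < B" "F dvd B" for N B
  proof -
    interpret caching_scheme K F Z S P N B
      using NB by unfold_locales
    have "secure_coded_caching_scheme K (real N * real ?c / real F) N B F S P"
      unfolding secure_coded_caching_scheme_def
      by (intro conjI has_memory[OF size] decodable demand_private)
    moreover have "real N * real ?c / real F / real N = real ?c / real F"
      using NB(1) assms(1) by simp
    ultimately show ?thesis
      using has_rate has_subpacketization by blast
  qed
  then show ?thesis
    using P unfolding assms(6) assms(8) by blast
qed

end
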